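(* Let $n\ge 1$, let $H_{\mathbb C}^n$ be complex hyperbolic space with geodesic distance $d$, let $G=U(1,n)$, let $G/MN$ be the space of horospheres of $H_{\mathbb C}^n$, and let $\mu$ be a nonzero positive $G$-invariant measure on $G/MN$. Then there is a constant $k>0$ such that for all $x,y\in H_{\mathbb C}^n$, $$\int_{G/MN} n[x,y](h)\,d\mu(h)=k\,d(x,y),$$ where $n[x,y](h)$ is the number of times that the horosphere $h$ meets the geodesic segment $[xy]$.
   Context: On $\mathbb C^{n+1}$ consider the hermitian form $\langle z,w\rangle=-\overline{z^0}w^0+\overline{z^1}w^1+\cdots+\overline{z^n}w^n$. Complex hyperbolic space $H_{\mathbb C}^n$ is the image in projective space $P_{\mathbb C}^n$ of the set of negative vectors $\{z\in\mathbb C^{n+1}:\langle z,z\rangle<0\}$; the same notation is used for a negative vector and its class. The geodesic distance is given by $\cosh d(x,y)=\frac{|\langle x,y\rangle|}{(\langle x,x\rangle\langle y,y\rangle)^{1/2}}$, and $[xy]$ denotes the geodesic segment from $x$ to $y$. The group $G=U(1,n)$ preserving the form acts isometrically and transitively on $H_{\mathbb C}^n$, and $H_{\mathbb C}^n=G/K$ with $K=U(1)\times U(n)$. Let $G=KAN$ be the Iwasawa decomposition and let $M$ be the centralizer of $A$ in $K$. Let $x_0$ be the origin $K$ in $G/K$ and let $\xi_0=Nx_0$. Horospheres are the $G$-translates $g\xi_0$ of $\xi_0$. The subgroup of $G$ mapping $\xi_0$ to itself is $MN$, so the space of horospheres is identified with the topological homogeneous space $G/MN$. There is a nonzero positive $G$-invariant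 (Radon) measure $\mu$ on $G/MN$. The number of times that $h$ meets $[xy]$ is the cardinality of $h\cap[xy]$. *)

theory Defs
  imports "HOL-Analysis.Analysis" "HOL-Algebra.Left_Coset"
begin

(* C^(n+1) is complex ^ 'n option with n = CARD('n) >= 1: the coordinate z^0 is z $ None and
   z^1, ..., z^n are the z $ Some i. *)

definition herm :: "complex ^ 'n::finite option \<Rightarrow> complex ^ 'n option \<Rightarrow> complex" where
  "herm z w = - cnj (z $ None) * w $ None + (\<Sum>i\<in>UNIV. cnj (z $ Some i) * w $ Some i)"

definition proj :: "complex ^ 'm::finite \<Rightarrow> (complex ^ 'm) set" where
  "proj z = {c *s z | c. c \<noteq> 0}"

(* herm z z is always real. *)
definition complex_hyperbolic :: "(complex ^ 'n::finite option) set set" where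
  "complex_hyperbolic = proj ` {z. Re (herm z z) < 0}"

definition hdist :: "(complex ^ 'n::finite option) set \<Rightarrow> (complex ^ 'n option) set \<Rightarrow> real" where
  "hdist X Y = (THE d. 0 \<le> d \<and>
     (\<forall>x\<in>X. \<forall>y\<in>Y. cosh d = cmod (herm x y) / sqrt (Re (herm x x) * Re (herm y y))))"

definition geodesic_path ::
  "(complex ^ 'n::finite option) set \<Rightarrow> (complex ^ 'n option) set \<Rightarrow>
   (real \<Rightarrow> (complex ^ 'n option) set) \<Rightarrow> bool" where
  "geodesic_path X Y \<gamma> \<longleftrightarrow> \<gamma> 0 = X \<and> \<gamma> (hdist X Y) = Y \<and>
     (\<forall>s\<in>{0..hdist X Y}. \<gamma> s \<in> complex_hyperbolic) \<and>
     (\<forall>s\<in>{0..hdist X Y}. \<forall>t\<in>{0..hdist X Y}. hdist (\<gamma> s) (\<gamma> t) = \<bar>s - t\<bar>)"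

(* The space is uniquely geodesic, so the union ranges over a single path (up to values
   outside the parameter interval). *)
definition geodesic_segment ::
  "(complex ^ 'n::finite option) set \<Rightarrow> (complex ^ 'n option) set \<Rightarrow>
   (complex ^ 'n option) set set" where
  "geodesic_segment X Y = (\<Union>\<gamma>\<in>{\<gamma>. geodesic_path X Y \<gamma>}. \<gamma> ` {0..hdist X Y})"

definition U1n :: "(complex ^ 'n::finite option ^ 'n option) monoid" where
  "U1n = \<lparr>carrier = {g. \<forall>z w. herm (g *v z) (g *v w) = herm z w}, mult = (**), one = mat 1\<rparr>"

definition act :: "complex ^ 'm::finite ^ 'm \<Rightarrow> (complex ^ 'm) set \<Rightarrow> (complex ^ 'm) set" where
  "act g X = (*v) g ` X"

definition mat_exp :: "complex ^ 'm::finite ^ 'm \<Rightarrow> complex ^ 'm ^ 'm" where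
  "mat_exp X = (\<Sum>k. (1 / fact k) *\<^sub>R (((**) X ^^ k) (mat 1)))"

definition u1n :: "(complex ^ 'n::finite option ^ 'n option) set" where
  "u1n = {X. \<forall>z w. herm (X *v z) w + herm z (X *v w) = 0}"

(* The Iwasawa decomposition G = KAN. K is U(1) x U(n), the block diagonal elements of G;
   the maximal abelian subspace spanned by H1 p generates boosts in the (z^0, z^1)-plane,
   where p is the index in 'n of the coordinate z^1; positive roots are those that are
   positive on H1 p. *)

definition Kgrp :: "(complex ^ 'n::finite option ^ 'n option) set" where
  "Kgrp = {g \<in> carrier U1n. \<forall>i. g $ None $ Some i = 0 \<and> g $ Some i $ None = 0}"

definition H1 :: "'n::finite \<Rightarrow> complex ^ 'n option ^ 'n option" where
  "H1 p = (\<chi> i j. if (i = None \<and> j = Some p) \<or> (i = Some p \<and> j = None) then 1 else 0)"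

definition Agrp :: "'n::finite \<Rightarrow> (complex ^ 'n option ^ 'n option) set" where
  "Agrp p = {mat_exp (t *\<^sub>R H1 p) | t. True}"

definition root_space :: "'n::finite \<Rightarrow> real \<Rightarrow> (complex ^ 'n option ^ 'n option) set" where
  "root_space p r = {X \<in> u1n. H1 p ** X - X ** H1 p = r *\<^sub>R X}"

definition Ngrp :: "'n::finite \<Rightarrow> (complex ^ 'n option ^ 'n option) set" where
  "Ngrp p = mat_exp ` span (\<Union>r\<in>{0<..}. root_space p r)"

definition Mgrp :: "'n::finite \<Rightarrow> (complex ^ 'n option ^ 'n option) set" where
  "Mgrp p = {m \<in> Kgrp. \<forall>a\<in>Agrp p. m ** a = a ** m}"

definition MN :: "'n::finite \<Rightarrow> (complex ^ 'n option ^ 'n option) set" where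
  "MN p = Mgrp p <#>\<^bsub>U1n\<^esub> Ngrp p"

definition origin :: "(complex ^ 'n::finite option) set" where
  "origin = proj (axis None 1)"

definition base_horosphere :: "'n::finite \<Rightarrow> (complex ^ 'n option) set set" where
  "base_horosphere p = {act g origin | g. g \<in> Ngrp p}"

(* The horosphere g \<xi>\<^sub>0 attached to the coset gMN; the union is constant since MN
   stabilizes \<xi>\<^sub>0. *)
definition horosphere ::
  "'n::finite \<Rightarrow> (complex ^ 'n option ^ 'n option) set \<Rightarrow> (complex ^ 'n option) set set" where
  "horosphere p C = (\<Union>g\<in>C. act g ` base_horosphere p)"

definition quotient_topology :: "'a topology \<Rightarrow> ('a \<Rightarrow> 'b) \<Rightarrow> 'b topology" where
  "quotient_topology X f =
     topology (\<lambda>U. U \<subseteq> f ` topspace X \<and> openin X {x \<in> topspace X. f x \<in> U})"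

lemma openin_quotient_topology:
  "openin (quotient_topology X f) U \<longleftrightarrow>
     U \<subseteq> f ` topspace X \<and> openin X {x \<in> topspace X. f x \<in> U}"
proof -
  have "istopology (\<lambda>U. U \<subseteq> f ` topspace X \<and> openin X {x \<in> topspace X. f x \<in> U})"
    unfolding istopology_def
  proof (rule conjI; clarify)
    fix S T
    assume "S \<subseteq> f ` topspace X" "openin X {x \<in> topspace X. f x \<in> S}"
      "openin X {x \<in> topspace X. f x \<in> T}"
    moreover have "{x \<in> topspace X. f x \<in> S \<inter> T} =
        {x \<in> topspace X. f x \<in> S} \<inter> {x \<in> topspace X. f x \<in> T}"
      by auto
    ultimately show "S \<inter> T \<subseteq> f ` topspace X \<and> openin X {x \<in> topspace X. f x \<in> S \<inter> T}"
      by auto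
  next
    fix \<K>
    assume \<K>: "\<forall>K\<in>\<K>. K \<subseteq> f ` topspace X \<and> openin X {x \<in> topspace X. f x \<in> K}"
    have "{x \<in> topspace X. f x \<in> \<Union>\<K>} = (\<Union>K\<in>\<K>. {x \<in> topspace X. f x \<in> K})"
      by auto
    then show "\<Union>\<K> \<subseteq> f ` topspace X \<and> openin X {x \<in> topspace X. f x \<in> \<Union>\<K>}"
      using \<K> by (auto intro!: openin_Union)
  qed
  then show ?thesis
    by (simp add: quotient_topology_def)
qed

lemma topspace_quotient_topology [simp]: "topspace (quotient_topology X f) = f ` topspace X"
proof
  show "topspace (quotient_topology X f) \<subseteq> f ` topspace X"
    using openin_quotient_topology[of X f "topspace (quotient_topology X f)"] by simp
  have "{x \<in> topspace X. f x \<in> f ` topspace X} = topspace X"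
    by auto
  then have "openin (quotient_topology X f) (f ` topspace X)"
    by (simp add: openin_quotient_topology)
  then show "f ` topspace X \<subseteq> topspace (quotient_topology X f)"
    by (rule openin_subset)
qed

lemma quotient_map_quotient_topology: "quotient_map X (quotient_topology X f) f"
  by (auto simp: quotient_map_def openin_quotient_topology)

definition horosphere_space :: "'n::finite \<Rightarrow> (complex ^ 'n option ^ 'n option) set topology" where
  "horosphere_space p =
     quotient_topology (top_of_set (carrier U1n)) (\<lambda>g. g <#\<^bsub>U1n\<^esub> MN p)"

lemma topspace_horosphere_space: "topspace (horosphere_space p) = lcosets\<^bsub>U1n\<^esub> (MN p)"
  by (auto simp: horosphere_space_def LCOSETS_def)

definition radon_measure :: "'a topology \<Rightarrow> 'a measure \<Rightarrow> bool" where
  "radon_measure X \<mu> \<longleftrightarrow>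
     space \<mu> = topspace X \<and>
     sets \<mu> = sigma_sets (topspace X) {U. openin X U} \<and>
     (\<forall>x\<in>topspace X. \<exists>U. openin X U \<and> x \<in> U \<and> emeasure \<mu> U < \<infinity>) \<and>
     (\<forall>B\<in>sets \<mu>. emeasure \<mu> B =
        (SUP C\<in>{C. compactin X C \<and> C \<in> sets \<mu> \<and> C \<subseteq> B}. emeasure \<mu> C))"

definition G_invariant :: "(complex ^ 'n::finite option ^ 'n option) set measure \<Rightarrow> bool" where
  "G_invariant \<mu> \<longleftrightarrow>
     (\<forall>g\<in>carrier U1n. \<forall>E\<in>sets \<mu>. emeasure \<mu> ((\<lambda>C. g <#\<^bsub>U1n\<^esub> C) ` E) = emeasure \<mu> E)"

(* Counting measure rather than card, which would be 0 on an infinite intersection. *)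
definition meets ::
  "'n::finite \<Rightarrow> (complex ^ 'n option) set \<Rightarrow> (complex ^ 'n option) set \<Rightarrow>
   (complex ^ 'n option ^ 'n option) set \<Rightarrow> ennreal" where
  "meets p X Y h = emeasure (count_space UNIV) (horosphere p h \<inter> geodesic_segment X Y)"

end

theory Submission
  imports Defs
begin

text \<open>
  A horosphere is a null vector up to a phase. Write \<open>v\<^sub>0 = e\<^sub>0 + e\<^sub>p\<close>. The stabilizer of \<open>v\<^sub>0\<close>
  up to unit scalars is exactly \<open>MN\<close>, so the coset \<open>cMN\<close> is the same thing as the vector \<open>c v\<^sub>0\<close> up to
  a phase, and the point \<open>z\<close> lies on the corresponding horosphere iff
  \<open>|\<langle>z, c v\<^sub>0\<rangle>|\<^sup>2 = -\<langle>z, z\<rangle>\<close> (\<open>MN_eq\<close>, \<open>mem_horo_coset\<close>, \<open>proj_mem_horosphere\<close>). A geodesic is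
  \<open>\<gamma>(s) = g (cosh s e\<^sub>0 + sinh s e\<^sub>p)\<close>, and \<open>\<langle>\<gamma>(s), c v\<^sub>0\<rangle>\<close> has the form
  \<open>\<alpha> exp(s) + \<beta> exp(-s)\<close>. The times at which the geodesic meets the horosphere are therefore governed by
  a nonzero quadratic polynomial in \<open>exp(2s)\<close>: there are at most two of them
  (\<open>crossing_times_bound\<close>).

  Let \<open>F(d)\<close> be the integral of the number of crossings over a segment of length \<open>d\<close>. Since \<open>G\<close> is
  transitive on pairs of points at a given distance and \<open>\<mu>\<close> is invariant, \<open>F(d)\<close> depends on \<open>d\<close> only.
  It remains to see that \<open>F\<close> is finite, additive and not zero, for a nonnegative additive function on
  \<open>[0, \<infinity>)\<close> is linear.

  \<^item> Finiteness (\<open>crossing_measure_finite\<close>): by the decomposition of null vectors as \<open>k a v\<^sub>0\<close> with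
    \<open>k\<close> in \<open>K\<close> and \<open>a\<close> in \<open>A\<close>, the horospheres that meet a bounded segment are images of a compact subset
    of \<open>G\<close>, and a Radon measure is finite on compact sets.

  \<^item> Additivity (\<open>crossing_measure_add\<close>): the counts on two adjacent segments add up, except at the
    horospheres through the common endpoint. These form a null set. By homogeneity their measure \<open>m\<close>
    does not depend on the point; spreading \<open>n\<close> distinct points over a unit segment gives
    \<open>n m \<le> F(1)\<close> for every \<open>n\<close>, whence \<open>m = 0\<close>.

  \<^item> Positivity (\<open>crossing_measure_1_neq_0\<close>): the horospheres that separate the two endpoints of a unit
    segment in a given order form a nonempty open set, whose translates cover \<open>G/MN\<close>. If it were a null
    set, every compact set would be one, and so would the whole space by inner regularity.
\<close>

section \<open>The hermitian form and its unitary group\<close>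

lemma herm_add_left: "herm (x + y) z = herm x z + herm y z"
  by (simp add: herm_def sum.distrib algebra_simps)

lemma herm_add_right: "herm z (x + y) = herm z x + herm z y"
  by (simp add: herm_def sum.distrib algebra_simps)

lemma herm_diff_left: "herm (x - y) z = herm x z - herm y z"
  by (simp add: herm_def sum_subtractf algebra_simps)

lemma herm_diff_right: "herm z (x - y) = herm z x - herm z y"
  by (simp add: herm_def sum_subtractf algebra_simps)

lemma herm_scale_left: "herm (c *s x) z = cnj c * herm x z"
  by (simp add: herm_def sum_distrib_left algebra_simps)

lemma herm_scale_right: "herm z (c *s x) = c * herm z x"
  by (simp add: herm_def sum_distrib_left algebra_simps)

lemma herm_zero [simp]: "herm 0 z = 0" "herm z 0 = 0"
  by (simp_all add: herm_def)

lemma cnj_herm: "cnj (herm z w) = herm w z"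
  by (simp add: herm_def mult.commute)

lemmas herm_simps = herm_add_left herm_add_right herm_diff_left herm_diff_right
  herm_scale_left herm_scale_right

lemma herm_axis_None [simp]:
  "herm (axis None 1) z = - z $ None" "herm z (axis None 1) = - cnj (z $ None)"
  by (simp_all add: herm_def axis_def)

lemma herm_axis_Some [simp]:
  "herm (axis (Some i) 1) z = z $ Some i" "herm z (axis (Some i) 1) = cnj (z $ Some i)"
  by (simp_all add: herm_def axis_def if_distrib[of cnj] if_distrib[of "\<lambda>x. x * _"]
      if_distrib[of "\<lambda>x. _ * x"] cong: if_cong)

lemma herm_self:
  "herm z z = of_real ((\<Sum>i\<in>UNIV. (cmod (z $ Some i))\<^sup>2) - (cmod (z $ None))\<^sup>2)"
  by (simp add: herm_def complex_norm_square[symmetric] mult.commute del: of_real_power)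

lemma Im_herm_self [simp]: "Im (herm z z) = 0"
  by (simp add: herm_self)

lemma of_real_Re_herm_self [simp]: "of_real (Re (herm z z)) = herm z z"
  by (simp add: herm_self)

lemma herm_spatial_eq_0:
  assumes "a $ None = 0" "herm a a = 0"
  shows "a = 0"
proof -
  have "(\<Sum>i\<in>UNIV. (cmod (a $ Some i))\<^sup>2) = 0"
    using assms by (simp add: herm_self del: of_real_sum)
  then have "a $ Some i = 0" for i
    by (simp add: sum_nonneg_eq_0_iff)
  then show ?thesis
    using assms(1) by (metis not_None_eq vec_eq_iff zero_index)
qed

lemma herm_nondegenerate:
  assumes "\<And>w. herm z w = 0"
  shows "z = 0"
proof -
  have "z $ i = 0" for i
    using assms[of "axis i 1"] by (cases i) auto
  then show ?thesis
    by (simp add: vec_eq_iff)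
qed

lemma herm_U1n: "g \<in> carrier U1n \<Longrightarrow> herm (g *v z) (g *v w) = herm z w"
  by (simp add: U1n_def)

lemma U1n_I: "(\<And>z w. herm (g *v z) (g *v w) = herm z w) \<Longrightarrow> g \<in> carrier U1n"
  by (simp add: U1n_def)

lemma mult_U1n [simp]: "x \<otimes>\<^bsub>U1n\<^esub> y = x ** y"
  by (simp add: U1n_def)

lemma mat_1_in_U1n [simp]: "mat 1 \<in> carrier U1n"
  by (simp add: U1n_def)

lemma matrix_mult_in_U1n: "g \<in> carrier U1n \<Longrightarrow> h \<in> carrier U1n \<Longrightarrow> g ** h \<in> carrier U1n"
  by (simp add: U1n_def flip: matrix_vector_mul_assoc)

lemma matrix_inv_U1n:
  assumes "g \<in> carrier U1n"
  shows "matrix_inv g ** g = mat 1" "g ** matrix_inv g = mat 1" "matrix_inv g \<in> carrier U1n"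
proof -
  have "inj ((*v) g)"
  proof (rule injI)
    fix x y assume "g *v x = g *v y"
    then have "herm (x - y) w = 0" for w
      using herm_U1n[OF assms, of "x - y" w] by (simp add: matrix_vector_mult_diff_distrib)
    then show "x = y"
      using herm_nondegenerate[of "x - y"] by simp
  qed
  then obtain B where "B ** g = mat 1"
    using matrix_left_invertible_injective by blast
  then have "\<exists>B. g ** B = mat 1 \<and> B ** g = mat 1"
    using matrix_left_right_inverse by blast
  then have "g ** matrix_inv g = mat 1 \<and> matrix_inv g ** g = mat 1"
    unfolding matrix_inv_def by (rule someI_ex)
  then show 1: "matrix_inv g ** g = mat 1" and 2: "g ** matrix_inv g = mat 1"
    by auto
  show "matrix_inv g \<in> carrier U1n"
  proof (rule U1n_I)
    fix z w
    show "herm (matrix_inv g *v z) (matrix_inv g *v w) = herm z w"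
      using herm_U1n[OF assms, of "matrix_inv g *v z" "matrix_inv g *v w"]
      by (simp add: matrix_vector_mul_assoc 2)
  qed
qed

lemma matrix_inv_U1n_cancel [simp]:
  assumes "g \<in> carrier U1n"
  shows "matrix_inv g *v (g *v z) = z" "g *v (matrix_inv g *v z) = z"
  using matrix_inv_U1n[OF assms] by (simp_all add: matrix_vector_mul_assoc)

definition reflection_matrix ::
  "complex ^ 'n::finite option \<Rightarrow> complex \<Rightarrow> complex ^ 'n option ^ 'n option" where
  "reflection_matrix a c = matrix (\<lambda>w. w - (herm a w / c) *s a)"

lemma reflection_matrix_mult: "reflection_matrix a c *v w = w - (herm a w / c) *s a"
  unfolding reflection_matrix_def
  by (rule matrix_works) (unfold_locales; simp add: herm_simps algebra_simps add_divide_distrib)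

text \<open>
  With \<open>a = x - y\<close> and \<open>c = \<langle>a, x\<rangle>\<close> the complex reflection \<open>w \<mapsto> w - (\<langle>a, w\<rangle> / c) a\<close> sends \<open>x\<close> to
  \<open>y\<close>. It preserves the form because \<open>\<langle>a, a\<rangle> = c + cnj c\<close>, which is what equal norms of \<open>x\<close> and
  \<open>y\<close> amount to. Transitivity on points, on pairs of points at a given distance and, together with the boosts,
  on null vectors up to a phase all come from this construction.
\<close>

lemma ex_U1n_mapsto:
  assumes "herm x x = herm y y" and c: "herm (x - y) x \<noteq> 0"
  obtains g where "g \<in> carrier U1n" "g *v x = y"
    "\<And>w. herm (x - y) w = 0 \<Longrightarrow> g *v w = w"
proof
  define a where "a = x - y"
  define c where "c = herm a x"
  let ?g = "reflection_matrix a c"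
  have "c \<noteq> 0"
    using c by (simp add: c_def a_def)
  have aa: "herm a a = c + cnj c"
    using assms(1) by (simp add: c_def a_def herm_simps cnj_herm)
  show "?g \<in> carrier U1n"
  proof (rule U1n_I)
    fix z w
    have "herm (?g *v z) (?g *v w) = herm z w
        + herm z a * herm a w * (herm a a / (c * cnj c) - 1 / c - 1 / cnj c)"
      using \<open>c \<noteq> 0\<close> by (simp add: reflection_matrix_mult herm_simps cnj_herm field_simps)
    also have "herm a a / (c * cnj c) - 1 / c - 1 / cnj c = 0"
      using \<open>c \<noteq> 0\<close> by (simp add: aa field_simps)
    finally show "herm (?g *v z) (?g *v w) = herm z w"
      by simp
  qed
  show "?g *v x = y"
    using \<open>c \<noteq> 0\<close> by (simp add: reflection_matrix_mult flip: c_def) (simp add: a_def)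
  show "?g *v w = w" if "herm (x - y) w = 0" for w
    using that by (simp add: reflection_matrix_mult a_def)
qed

text \<open>
  Two vectors with the same component along \<open>e\<^sub>0\<close> are related by an element that fixes \<open>e\<^sub>0\<close>: their
  difference is orthogonal to \<open>e\<^sub>0\<close>, where the form is positive definite, so the reflection is
  undefined only if the difference vanishes.
\<close>

lemma ex_stabilizer_mapsto:
  assumes "herm x x = herm y y" and "x $ None = y $ None"
  obtains k where "k \<in> carrier U1n" "k *v x = y" "k *v axis None 1 = axis None 1"
proof (cases "herm (x - y) x = 0")
  case True
  have "herm (x - y) (x - y) = herm (x - y) x + cnj (herm (x - y) x)"
    using assms(1) by (simp add: herm_simps cnj_herm)
  then have "x - y = 0"
    using True assms(2) by (intro herm_spatial_eq_0) auto
  then show ?thesis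
    by (intro that[of "mat 1"]) auto
next
  case False
  have "herm (x - y) (axis None 1) = 0"
    using assms(2) by simp
  then show ?thesis
    using ex_U1n_mapsto[OF assms(1) False] that by metis
qed

section \<open>The unipotent group\<close>

text \<open>
  The fixed vector of \<open>N\<close>; it spans the boundary point at which the base horosphere is centred.
\<close>

definition null_vec :: "'n::finite \<Rightarrow> complex ^ 'n option" where
  "null_vec p = axis None 1 + axis (Some p) 1"

lemma null_vec_nth [simp]: "null_vec p $ None = 1" "null_vec p $ Some p = 1"
  "i \<noteq> p \<Longrightarrow> null_vec p $ Some i = 0"
  by (simp_all add: null_vec_def axis_def)

lemma herm_null_vec:
  "herm (null_vec p) z = z $ Some p - z $ None"
  "herm z (null_vec p) = cnj (z $ Some p) - cnj (z $ None)"
  by (simp_all add: null_vec_def herm_simps)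

lemma matrix_vector_mult_scaleR_left:
  fixes A :: "complex ^ 'm::finite ^ 'k"
  shows "(r *\<^sub>R A) *v z = of_real r *s (A *v z)"
  by (simp add: vec_eq_iff matrix_vector_mult_def sum_distrib_left)
     (simp add: scaleR_conv_of_real mult.assoc)

lemma H1_mult: "H1 p *v z = (z $ Some p) *s axis None 1 + (z $ None) *s axis (Some p) 1"
proof -
  have "(H1 p *v z) $ i = ((z $ Some p) *s axis None 1 + (z $ None) *s axis (Some p) 1) $ i" for i
  proof (cases i)
    case None
    then show ?thesis
      by (simp add: H1_def matrix_vector_mult_def axis_def if_distrib[of "\<lambda>x. x * _"] cong: if_cong)
  next
    case (Some k)
    then show ?thesis
      by (cases "k = p")
         (simp_all add: H1_def matrix_vector_mult_def axis_def if_distrib[of "\<lambda>x. x * _"] cong: if_cong)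
  qed
  then show ?thesis
    by (simp add: vec_eq_iff)
qed

lemma mat_exp_nilpotent:
  fixes X :: "complex ^ 'm::finite ^ 'm"
  assumes "X ** (X ** X) = 0"
  shows "mat_exp X = mat 1 + X + (1 / 2) *\<^sub>R (X ** X)"
proof -
  have zero: "((**) X ^^ k) 0 = 0" for k
    by (induction k) auto
  have "((**) X ^^ k) (mat 1) = 0" if "k \<notin> {0, 1, 2}" for k
  proof -
    have "k = (k - 3) + 3"
      using that by auto
    then have "((**) X ^^ k) (mat 1) = ((**) X ^^ (k - 3)) (((**) X ^^ 3) (mat 1))"
      by (metis funpow_add o_apply)
    then show ?thesis
      using assms by (simp add: numeral_3_eq_3 zero)
  qed
  then have "mat_exp X = (\<Sum>k\<in>{0, 1, 2}. (1 / fact k) *\<^sub>R (((**) X ^^ k) (mat 1)))"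
    unfolding mat_exp_def by (intro suminf_finite) auto
  then show ?thesis
    by (simp add: numeral_2_eq_2)
qed

lemma herm_u1n: "X \<in> u1n \<Longrightarrow> herm (X *v z) w = - herm z (X *v w)"
  by (simp add: u1n_def eq_neg_iff_add_eq_0)

text \<open>
  The matrix \<open>H1 p\<close> interchanges \<open>e\<^sub>0\<close> and \<open>e\<^sub>p\<close> and vanishes on the other coordinates.
\<close>

lemma H1_eigenvector:
  assumes "H1 p *v y = of_real l *s y" and "0 < l"
  shows "y = (y $ None) *s null_vec p" and "l \<noteq> 1 \<Longrightarrow> y = 0"
proof -
  have eq: "(if i = None then y $ Some p else if i = Some p then y $ None else 0) = of_real l * y $ i"
    for i
    using arg_cong[OF assms(1), of "\<lambda>v. v $ i"] by (auto simp: H1_mult axis_def split: if_splits)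
  have p: "y $ Some p = of_real l * y $ None" and 0: "y $ None = of_real l * y $ Some p"
    using eq[of None] eq[of "Some p"] by auto
  have i: "y $ Some i = 0" if "i \<noteq> p" for i
    using eq[of "Some i"] that assms(2) by auto
  have *: "y $ None = 0" if "l \<noteq> 1"
  proof -
    have "(complex_of_real (l\<^sup>2) - of_real 1) * y $ None = 0"
      using p 0 by (simp add: power2_eq_square algebra_simps)
    moreover have "l\<^sup>2 \<noteq> 1"
      using that assms(2) by (auto simp: power2_eq_1_iff)
    ultimately show ?thesis
      by (simp del: of_real_power of_real_1)
  qed
  have yp: "y $ Some p = y $ None"
  proof (cases "l = 1")
    case True
    then show ?thesis
      using p by simp
  next
    case False
    then show ?thesis
      using p *[OF False] by simp
  qed
  have "y $ i = ((y $ None) *s null_vec p) $ i" for i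
  proof (cases i)
    case None
    then show ?thesis
      by simp
  next
    case (Some k)
    then show ?thesis
      using i[of k] yp by (cases "k = p") simp_all
  qed
  then show 1: "y = (y $ None) *s null_vec p"
    unfolding vec_eq_iff by blast
  show "y = 0" if "l \<noteq> 1"
    by (subst 1) (simp add: *[OF that])
qed

text \<open>
  A root vector for the root \<open>r\<close> shifts eigenvalues of \<open>H1 p\<close> by \<open>r\<close>. The vector \<open>v\<^sub>0\<close> has the
  largest eigenvalue, and its orthogonal complement is spanned by eigenvectors for \<open>0\<close> and \<open>1\<close>.
\<close>

lemma root_space_act:
  assumes "X \<in> root_space p r" and "0 < r"
  shows "X *v null_vec p = 0"
    and "herm (null_vec p) w = 0 \<Longrightarrow> \<exists>c. X *v w = c *s null_vec p"
proof -
  have br: "H1 p *v (X *v z) = X *v (H1 p *v z) + of_real r *s (X *v z)" for z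
  proof -
    have "(H1 p ** X - X ** H1 p) *v z = (r *\<^sub>R X) *v z"
      using assms(1) by (simp add: root_space_def)
    then show ?thesis
      by (simp add: matrix_vector_mult_diff_rdistrib matrix_vector_mult_scaleR_left
          flip: matrix_vector_mul_assoc) (simp add: algebra_simps)
  qed
  have "H1 p *v null_vec p = null_vec p"
    by (simp add: H1_mult) (simp add: null_vec_def)
  then have "H1 p *v (X *v null_vec p) = of_real (1 + r) *s (X *v null_vec p)"
    using br[of "null_vec p"] by (simp add: vector_sadd_rdistrib)
  then show 1: "X *v null_vec p = 0"
    by (rule H1_eigenvector(2)) (use assms(2) in auto)
  show "\<exists>c. X *v w = c *s null_vec p" if "herm (null_vec p) w = 0"
  proof -
    define w' where "w' = w - (w $ None) *s null_vec p"
    have "H1 p *v w' = 0"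
      using that by (simp add: H1_mult w'_def herm_null_vec)
    then have "H1 p *v (X *v w') = of_real r *s (X *v w')"
      using br[of w'] by simp
    from H1_eigenvector(1)[OF this assms(2)] obtain c where "X *v w' = c *s null_vec p"
      by blast
    moreover have "X *v w' = X *v w"
      using 1 by (simp add: w'_def matrix_vector_mult_diff_distrib vector_scalar_commute)
    ultimately show ?thesis
      by auto
  qed
qed

text \<open>
  The three properties are linear in \<open>X\<close> and hence pass to the span; they express that \<open>X\<close> is skew and
  lowers the flag \<open>\<complex> v\<^sub>0 \<subseteq> {v\<^sub>0}\<^sup>\<bottom>\<close>. The nilpotency \<open>X\<^sup>3 = 0\<close>, which is not linear, is deduced
  from them afterwards.
\<close>

lemma positive_root_span:
  assumes "X \<in> span (\<Union>r\<in>{0<..}. root_space p r)"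
  shows "X \<in> u1n" and "X *v null_vec p = 0"
    and "herm (null_vec p) w = 0 \<Longrightarrow> \<exists>c. X *v w = c *s null_vec p"
proof -
  define P where "P = (\<lambda>X. X \<in> u1n \<and> X *v null_vec p = 0 \<and>
    (\<forall>w. herm (null_vec p) w = 0 \<longrightarrow> (\<exists>c. X *v w = c *s null_vec p)))"
  have "P X"
    using assms
  proof (rule span_induct)
    show "subspace {X. P X}"
    proof (rule subspaceI)
      show "0 \<in> {X. P X}"
        by (auto simp: P_def u1n_def intro: exI[of _ 0])
      fix X Y assume X: "X \<in> {X. P X}" and Y: "Y \<in> {X. P X}"
      have "\<exists>c. (X + Y) *v w = c *s null_vec p" if w: "herm (null_vec p) w = 0" for w
      proof -
        obtain c d where "X *v w = c *s null_vec p" "Y *v w = d *s null_vec p"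
          using X Y w unfolding P_def by blast
        then have "(X + Y) *v w = (c + d) *s null_vec p"
          by (simp add: matrix_vector_mult_add_rdistrib vector_sadd_rdistrib)
        then show ?thesis ..
      qed
      then show "X + Y \<in> {X. P X}"
        using X Y
        by (simp add: P_def matrix_vector_mult_add_rdistrib u1n_def herm_simps)
           (simp add: algebra_simps)
    next
      fix c X assume X: "X \<in> {X. P X}"
      have "\<exists>d. (c *\<^sub>R X) *v w = d *s null_vec p" if w: "herm (null_vec p) w = 0" for w
      proof -
        obtain d where "X *v w = d *s null_vec p"
          using X w unfolding P_def by blast
        then have "(c *\<^sub>R X) *v w = (of_real c * d) *s null_vec p"
          by (simp add: matrix_vector_mult_scaleR_left vector_smult_assoc)
        then show ?thesis ..
      qed
      then show "c *\<^sub>R X \<in> {X. P X}"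
        using X by (simp add: P_def matrix_vector_mult_scaleR_left u1n_def herm_simps
            flip: distrib_left)
    qed
    show "P X" if "X \<in> (\<Union>r\<in>{0<..}. root_space p r)" for X
      using that root_space_act unfolding P_def by (fastforce simp: root_space_def)
  qed
  then show "X \<in> u1n" "X *v null_vec p = 0"
    "herm (null_vec p) w = 0 \<Longrightarrow> \<exists>c. X *v w = c *s null_vec p"
    by (auto simp: P_def)
qed

text \<open>
  \<open>X\<close> maps every vector into the orthogonal complement of \<open>v\<^sub>0\<close>, that complement into the line of
  \<open>v\<^sub>0\<close>, and this line to \<open>0\<close>.
\<close>

lemma positive_root_cube:
  assumes "X \<in> span (\<Union>r\<in>{0<..}. root_space p r)"
  shows "X *v (X *v (X *v w)) = 0"
proof -
  note X = positive_root_span[OF assms]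
  have "herm (null_vec p) (X *v w) = 0"
    using herm_u1n[OF X(1), of "null_vec p" w] X(2) by simp
  then obtain c where "X *v (X *v w) = c *s null_vec p"
    using X(3) by blast
  then show ?thesis
    by (simp add: vector_scalar_commute X(2))
qed

lemma mat_exp_positive_root:
  assumes "X \<in> span (\<Union>r\<in>{0<..}. root_space p r)"
  shows "mat_exp X *v w = w + X *v w + (1 / 2) *s (X *v (X *v w))"
proof -
  have "X ** (X ** X) = 0"
    using positive_root_cube[OF assms] by (simp add: matrix_eq flip: matrix_vector_mul_assoc)
  then show ?thesis
    by (simp add: mat_exp_nilpotent matrix_vector_mult_add_rdistrib matrix_vector_mult_scaleR_left
        flip: matrix_vector_mul_assoc)
qed

lemma Ngrp_U1n:
  assumes "\<nu> \<in> Ngrp p"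
  shows "\<nu> \<in> carrier U1n" and "\<nu> *v null_vec p = null_vec p"
proof -
  obtain X where X: "X \<in> span (\<Union>r\<in>{0<..}. root_space p r)" and \<nu>: "\<nu> = mat_exp X"
    using assms by (auto simp: Ngrp_def)
  note exp = mat_exp_positive_root[OF X, folded \<nu>]
  note skew = herm_u1n[OF positive_root_span(1)[OF X]]
  show "\<nu> \<in> carrier U1n"
  proof (rule U1n_I)
    fix z w
    show "herm (\<nu> *v z) (\<nu> *v w) = herm z w"
      by (simp add: exp herm_simps skew positive_root_cube[OF X] field_simps)
  qed
  show "\<nu> *v null_vec p = null_vec p"
    by (simp add: exp positive_root_span(2)[OF X])
qed

lemma Ngrp_inverse:
  assumes "\<nu> \<in> Ngrp p"
  obtains \<nu>' where "\<nu>' \<in> Ngrp p" "\<nu> ** \<nu>' = mat 1"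
proof -
  obtain X where X: "X \<in> span (\<Union>r\<in>{0<..}. root_space p r)" and \<nu>: "\<nu> = mat_exp X"
    using assms by (auto simp: Ngrp_def)
  have X': "- X \<in> span (\<Union>r\<in>{0<..}. root_space p r)"
    using X by (rule span_neg)
  have neg: "(- X) *v w = - (X *v w)" for w
    using matrix_vector_mult_diff_rdistrib[of 0 X w] by simp
  have neg': "X *v (- w) = - (X *v w)" for w
    using matrix_vector_mult_diff_distrib[of X 0 w] by simp
  have "\<nu> ** mat_exp (- X) = mat 1"
    unfolding matrix_eq
    by (simp add: \<nu> mat_exp_positive_root[OF X] mat_exp_positive_root[OF X'] neg neg'
        positive_root_cube[OF X] matrix_vector_right_distrib matrix_vector_mult_diff_distrib
        vector_scalar_commute flip: matrix_vector_mul_assoc)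
       (simp add: vec_eq_iff)
  then show ?thesis
    using X' by (intro that[of "mat_exp (- X)"]) (auto simp: Ngrp_def)
qed

text \<open>
  \<open>N\<close> is transitive on the vectors of norm \<open>-1\<close> with \<open>\<langle>v\<^sub>0, z\<rangle> = -1\<close>. Writing
  \<open>z = e\<^sub>0 + \<tau> v\<^sub>0 + b\<close> with \<open>b\<close> orthogonal to \<open>e\<^sub>0\<close> and \<open>e\<^sub>p\<close>, the norm condition reads
  \<open>2 Re \<tau> = \<langle>b, b\<rangle>\<close>. The vector \<open>b\<close> is produced by a root vector for the root \<open>1\<close>, whose square
  contributes the real part of \<open>\<tau>\<close>, and the imaginary part of \<open>\<tau>\<close> by one for the root \<open>2\<close>.
\<close>

lemma Ngrp_transitive:
  assumes "herm z z = -1" and "herm (null_vec p) z = -1"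
  obtains \<nu> where "\<nu> \<in> Ngrp p" "\<nu> *v axis None 1 = z"
proof -
  define v where "v = null_vec p"
  define \<tau> where "\<tau> = z $ Some p"
  define b where "b = z - axis None 1 - \<tau> *s v"
  define k where "k = - \<i> * of_real (Im \<tau>)"
  have z: "z = axis None 1 + \<tau> *s v + b"
    by (simp add: b_def)
  have z0: "z $ None = 1 + \<tau>"
    using assms(2) by (simp add: herm_null_vec \<tau>_def algebra_simps)
  have b0: "b $ None = 0"
    using z0 by (simp add: b_def v_def)
  have bp: "b $ Some p = 0"
    by (simp add: b_def v_def \<tau>_def axis_def)
  have bv: "herm b v = 0" "herm v b = 0"
    using b0 bp by (simp_all add: v_def herm_null_vec)
  have vv: "herm v v = 0"
    by (simp add: v_def herm_null_vec)
  have v0: "v $ None = 1"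
    by (simp add: v_def)
  have k: "cnj k = - k"
    by (simp add: k_def)
  \<comment> \<open>Skewness of \<open>X1\<close> is antisymmetry in \<open>v\<close> and \<open>b\<close>; for \<open>X2\<close> it needs \<open>k\<close> imaginary.\<close>
  define X1 where "X1 = matrix (\<lambda>w. herm b w *s v - herm v w *s b)"
  define X2 where "X2 = matrix (\<lambda>w. (k * herm v w) *s v)"
  have X1: "X1 *v w = herm b w *s v - herm v w *s b" for w
    unfolding X1_def by (rule matrix_works) (unfold_locales; simp add: herm_simps algebra_simps)
  have X2: "X2 *v w = (k * herm v w) *s v" for w
    unfolding X2_def by (rule matrix_works) (unfold_locales; simp add: herm_simps algebra_simps)
  have Hv: "H1 p *v v = v"
    by (simp add: H1_mult v_def) (simp add: null_vec_def)
  have Hb: "H1 p *v b = 0"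
    using b0 bp by (simp add: H1_mult)
  have vH: "herm v (H1 p *v w) = - herm v w" "herm b (H1 p *v w) = 0" for w
    using b0 bp v0 by (simp_all add: H1_mult herm_simps herm_null_vec v_def)
  have "X1 \<in> root_space p 1"
    unfolding root_space_def u1n_def
    by (simp add: X1 herm_simps matrix_eq matrix_vector_mult_diff_rdistrib Hv Hb vH
        matrix_vector_mult_diff_distrib vector_scalar_commute cnj_herm
        flip: matrix_vector_mul_assoc)
  moreover have "X2 \<in> root_space p 2"
    unfolding root_space_def u1n_def
    by (simp add: X2 herm_simps matrix_eq matrix_vector_mult_diff_rdistrib Hv Hb vH
        matrix_vector_mult_scaleR_left vector_scalar_commute cnj_herm k
        flip: matrix_vector_mul_assoc)
       (simp add: vec_eq_iff)
  ultimately have X: "X1 + X2 \<in> span (\<Union>r\<in>{0<..}. root_space p r)"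
    by (intro span_add span_base) auto
  have e: "(X1 + X2) *v axis None 1 = b - k *s v"
    using b0 by (simp add: matrix_vector_mult_add_rdistrib X1 X2 v0)
  have "(X1 + X2) *v b = herm b b *s v" "(X1 + X2) *v v = 0"
    by (simp_all add: matrix_vector_mult_add_rdistrib X1 X2 bv vv)
  then have e2: "(X1 + X2) *v (b - k *s v) = herm b b *s v"
    by (simp add: matrix_vector_mult_diff_distrib vector_scalar_commute)
  have bb: "herm b b = of_real (2 * Re \<tau>)"
  proof -
    have "herm z z = herm b b - 1 - (\<tau> + cnj \<tau>)"
      using b0 by (simp add: z herm_simps bv vv v0)
    then show ?thesis
      using assms(1) by (simp add: complex_add_cnj)
  qed
  have \<tau>: "(1 / 2) * herm b b - k = \<tau>"
    by (simp add: bb k_def complex_eq_iff)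
  have "mat_exp (X1 + X2) *v axis None 1
      = axis None 1 + b + ((1 / 2) * herm b b - k) *s v"
    by (simp add: mat_exp_positive_root[OF X] e e2)
  then have "mat_exp (X1 + X2) *v axis None 1 = z"
    unfolding \<tau> by (simp add: z)
  then show ?thesis
    using X by (intro that[of "mat_exp (X1 + X2)"]) (auto simp: Ngrp_def)
qed

section \<open>Boosts\<close>

lemma axis_option_nth [simp]:
  fixes i j :: "'n::finite"
  shows "axis None 1 $ None = (1::complex)" "axis None 1 $ Some i = (0::complex)"
  and  "axis (Some i) 1 $ None = (0::complex)" "axis (Some i) 1 $ Some i = (1::complex)"
  and "i \<noteq> j \<Longrightarrow> axis (Some i) 1 $ Some j = (0::complex)"
  by (simp_all add: axis_def)

definition boost :: "'n::finite \<Rightarrow> real \<Rightarrow> complex ^ 'n option ^ 'n option" where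
  "boost p t = mat_exp (t *\<^sub>R H1 p)"

lemma H1_square_mult:
  "(H1 p ** H1 p) *v z = (z $ None) *s axis None 1 + (z $ Some p) *s axis (Some p) 1"
  by (simp add: H1_mult axis_def flip: matrix_vector_mul_assoc)

lemma H1_cube: "H1 p ** (H1 p ** H1 p) = H1 p"
  unfolding matrix_eq
  by (simp add: H1_mult axis_def flip: matrix_vector_mul_assoc)

text \<open>
  Since \<open>H1 p\<close> is equal to its cube, the exponential series splits into the series of \<open>cosh\<close> along
  its square and the series of \<open>sinh\<close> along \<open>H1 p\<close>; the term for \<open>k = 0\<close> needs the correction
  \<open>1 - (H1 p)\<^sup>2\<close>.
\<close>

lemma boost_mult:
  "boost p t *v z = z
    + (of_real (cosh t - 1) * z $ None + of_real (sinh t) * z $ Some p) *s axis None 1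
    + (of_real (sinh t) * z $ None + of_real (cosh t - 1) * z $ Some p) *s axis (Some p) 1"
proof -
  let ?H = "H1 p"
  define C where "C = (\<lambda>k. if even k then t ^ k /\<^sub>R fact k else 0)"
  define S where "S = (\<lambda>k. if even k then 0 else t ^ k /\<^sub>R fact k)"
  have pow: "((**) (t *\<^sub>R ?H) ^^ k) (mat 1)
      = t ^ k *\<^sub>R (if k = 0 then mat 1 else if even k then ?H ** ?H else ?H)" for k
    by (induction k) (auto simp: matrix_scalar_ac H1_cube simp flip: scalar_matrix_assoc)
  have scaled: "(1 / fact k) *\<^sub>R ((**) (t *\<^sub>R ?H) ^^ k) (mat 1)
      = (if k = 0 then mat 1 - ?H ** ?H else 0) + C k *\<^sub>R (?H ** ?H) + S k *\<^sub>R ?H" for k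
    unfolding pow C_def S_def by (auto simp: divide_inverse mult.commute)
  have "C sums cosh t" "S sums sinh t"
    unfolding C_def S_def by (rule cosh_converges, rule sinh_converges)
  then have "(\<lambda>k. C k *\<^sub>R (?H ** ?H)) sums (cosh t *\<^sub>R (?H ** ?H))"
      "(\<lambda>k. S k *\<^sub>R ?H) sums (sinh t *\<^sub>R ?H)"
    by (auto intro: bounded_linear.sums[OF bounded_linear_scaleR_left])
  moreover have "(\<lambda>k. if k = 0 then mat 1 - ?H ** ?H else 0) sums (mat 1 - ?H ** ?H)"
    using sums_single[of 0 "\<lambda>_. mat 1 - ?H ** ?H"] by simp
  ultimately have "(\<lambda>k. (1 / fact k) *\<^sub>R ((**) (t *\<^sub>R ?H) ^^ k) (mat 1)) sums
      ((mat 1 - ?H ** ?H) + cosh t *\<^sub>R (?H ** ?H) + sinh t *\<^sub>R ?H)"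
    unfolding scaled by (intro sums_add)
  then have "boost p t = (mat 1 - ?H ** ?H) + cosh t *\<^sub>R (?H ** ?H) + sinh t *\<^sub>R ?H"
    unfolding boost_def mat_exp_def by (rule sums_unique[symmetric])
  then show ?thesis
    by (simp add: matrix_vector_mult_add_rdistrib matrix_vector_mult_diff_rdistrib
        matrix_vector_mult_scaleR_left H1_square_mult)
       (simp add: H1_mult algebra_simps)
qed

lemma boost_U1n [simp]: "boost p t \<in> carrier U1n"
proof (rule U1n_I)
  fix z w
  define c s where "c = complex_of_real (cosh t)" and "s = complex_of_real (sinh t)"
  have cs: "c * c = 1 + s * s"
    using cosh_square_eq[of t] unfolding c_def s_def
    by (metis of_real_1 of_real_add of_real_mult power2_eq_square add.commute)
  have cnj: "cnj c = c" "cnj s = s"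
    by (simp_all add: c_def s_def)
  have "herm (boost p t *v z) (boost p t *v w) = herm z w
      + (c * c - s * s - 1) * (cnj (z $ Some p) * w $ Some p - cnj (z $ None) * w $ None)"
    unfolding boost_mult of_real_diff c_def[symmetric] s_def[symmetric]
    by (simp add: herm_simps cnj) (simp add: algebra_simps)
  then show "herm (boost p t *v z) (boost p t *v w) = herm z w"
    by (simp add: cs)
qed

text \<open>
  The unit speed geodesic through the origin in the direction of \<open>e\<^sub>p\<close>, lifted to vectors of norm \<open>-1\<close>.
\<close>

definition geo :: "'n::finite \<Rightarrow> real \<Rightarrow> complex ^ 'n option" where
  "geo p s = of_real (cosh s) *s axis None 1 + of_real (sinh s) *s axis (Some p) 1"

lemma geo_nth [simp]: "geo p s $ None = of_real (cosh s)" "geo p s $ Some p = of_real (sinh s)"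
  "i \<noteq> p \<Longrightarrow> geo p s $ Some i = 0"
  by (simp_all add: geo_def)

lemma geo_0 [simp]: "geo p 0 = axis None 1"
  by (simp add: geo_def)

lemma herm_geo: "herm (geo p s) (geo p t) = - of_real (cosh (t - s))"
  by (simp add: geo_def[of p s] herm_simps cosh_diff mult.commute)

lemma vec_option_eqI:
  assumes "x $ None = y $ None" "x $ Some p = y $ Some p"
    "\<And>i. i \<noteq> p \<Longrightarrow> x $ Some i = y $ Some i"
  shows "x = y"
  unfolding vec_eq_iff using assms by (metis not_Some_eq)

lemma boost_geo: "boost p t *v geo p s = geo p (t + s)"
  by (rule vec_option_eqI[of _ _ p])
     (simp_all add: boost_mult axis_def cosh_add sinh_add algebra_simps)

lemma boost_null_vec: "boost p t *v null_vec p = of_real (exp t) *s null_vec p"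
  by (rule vec_option_eqI[of _ _ p])
     (simp_all add: boost_mult axis_def algebra_simps flip: cosh_plus_sinh)

section \<open>The stabilizer of a horosphere\<close>

lemma matrix_vector_mult_axis:
  fixes A :: "complex ^ 'm::finite ^ 'k"
  shows "(A *v axis j 1) $ i = A $ i $ j"
  by (simp add: matrix_vector_mult_def axis_def if_distrib[of "\<lambda>x. _ * x"] axis_def cong: if_cong)

text \<open>
  An element \<open>m\<close> of \<open>K\<close> acts on \<open>e\<^sub>0\<close> by a phase. Comparing \<open>m a e\<^sub>0\<close> with \<open>a m e\<^sub>0\<close> for a
  single nontrivial boost \<open>a\<close> shows that \<open>m\<close> acts on \<open>e\<^sub>p\<close> by the same phase.
\<close>

lemma Mgrp_iff:
  "m \<in> Mgrp p \<longleftrightarrow> m \<in> carrier U1n \<and>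
    (\<exists>u. cmod u = 1 \<and> m *v axis None 1 = u *s axis None 1 \<and>
         m *v axis (Some p) 1 = u *s axis (Some p) 1)"
proof safe
  assume m: "m \<in> Mgrp p"
  then have K: "m \<in> carrier U1n" "m $ Some i $ None = 0" for i
    by (auto simp: Mgrp_def Kgrp_def)
  show "m \<in> carrier U1n"
    by (rule K)
  have comm: "m *v (boost p t *v z) = boost p t *v (m *v z)" for t z
  proof -
    have "m ** boost p t = boost p t ** m"
      using m by (auto simp: Mgrp_def Agrp_def boost_def)
    then show ?thesis
      by (simp add: matrix_vector_mul_assoc)
  qed
  define u where "u = m $ None $ None"
  have e0: "m *v axis None 1 = u *s axis None 1"
    unfolding vec_eq_iff matrix_vector_mult_axis
    using K(2) by (auto simp: u_def axis_def split: option.splits)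
  have "cnj u * u = 1"
    using herm_U1n[OF K(1), of "axis None 1" "axis None 1"] by (simp add: e0 herm_simps mult.commute)
  then have "(of_real ((cmod u)\<^sup>2) :: complex) = of_real 1"
    using complex_norm_square[of u] by (metis mult.commute of_real_1)
  then have u: "cmod u = 1"
    unfolding of_real_eq_iff using norm_ge_zero[of u]
    by (auto simp: power2_eq_1_iff simp del: norm_ge_zero)
  have geo: "m *v geo p t = of_real (cosh t) *s (u *s axis None 1)
      + of_real (sinh t) *s (m *v axis (Some p) 1)" for t
    by (simp add: geo_def matrix_vector_right_distrib vector_scalar_commute e0)
  have "m *v geo p t = boost p t *v (u *s axis None 1)" for t
    using comm[of t "axis None 1"] boost_geo[of p t 0] by (simp add: e0)
  also have "boost p t *v (u *s axis None 1) = u *s geo p t" for t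
    using boost_geo[of p t 0] by (simp add: vector_scalar_commute)
  finally have "of_real (sinh 1) *s (m *v axis (Some p) 1) = of_real (sinh 1) *s (u *s axis (Some p) (1::complex))"
    unfolding geo by (simp add: geo_def) (simp add: mult.commute)
  then have "m *v axis (Some p) 1 = u *s axis (Some p) 1"
    unfolding vector_mul_lcancel by simp
  with e0 u show "\<exists>u. cmod u = 1 \<and> m *v axis None 1 = u *s axis None 1 \<and>
         m *v axis (Some p) 1 = u *s axis (Some p) 1"
    by blast
next
  fix u assume m: "m \<in> carrier U1n" and u: "cmod u = 1"
    and e0: "m *v axis None 1 = u *s axis None 1" and ep: "m *v axis (Some p) 1 = u *s axis (Some p) 1"
  have uu: "u * cnj u = 1"
    using u complex_norm_square[of u] by simp
  have n0: "(m *v z) $ None = u * z $ None" for z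
  proof -
    have "cnj u * (m *v z) $ None = z $ None"
      using herm_U1n[OF m, of "axis None 1" z] by (simp add: e0 herm_simps)
    then show ?thesis
      using uu by (metis mult.assoc mult_1)
  qed
  have np: "(m *v z) $ Some p = u * z $ Some p" for z
  proof -
    have "cnj u * (m *v z) $ Some p = z $ Some p"
      using herm_U1n[OF m, of "axis (Some p) 1" z] by (simp add: ep herm_simps)
    then show ?thesis
      using uu by (metis mult.assoc mult_1)
  qed
  have "m $ None $ Some i = 0 \<and> m $ Some i $ None = 0" for i
    using n0[of "axis (Some i) 1"] arg_cong[OF e0, of "\<lambda>v. v $ Some i"]
    by (simp add: matrix_vector_mult_axis)
  moreover have "m ** boost p t = boost p t ** m" for t
    unfolding matrix_eq
    by (simp add: boost_mult n0 np e0 ep matrix_vector_right_distrib vector_scalar_commute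
        algebra_simps flip: matrix_vector_mul_assoc)
  ultimately show "m \<in> Mgrp p"
    using m by (auto simp: Mgrp_def Kgrp_def Agrp_def boost_def)
qed

text \<open>
  If \<open>g\<close> fixes \<open>v\<^sub>0\<close> up to the phase \<open>u\<close>, then \<open>u g\<^sup>-\<^sup>1 e\<^sub>0\<close> satisfies the hypotheses of
  \<open>Ngrp_transitive\<close>, hence is \<open>\<nu> e\<^sub>0\<close> for some \<open>\<nu>\<close> in \<open>N\<close>. Now \<open>g \<nu>\<close> multiplies both \<open>e\<^sub>0\<close>
  and \<open>v\<^sub>0\<close>, hence \<open>e\<^sub>p\<close>, by \<open>u\<close>, which places it in \<open>M\<close>.
\<close>

lemma MN_eq:
  "MN p = {g \<in> carrier U1n. \<exists>u. cmod u = 1 \<and> g *v null_vec p = u *s null_vec p}"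
proof (intro Set.set_eqI iffI)
  fix g assume "g \<in> MN p"
  then obtain m \<nu> where m: "m \<in> Mgrp p" and \<nu>: "\<nu> \<in> Ngrp p" and g: "g = m ** \<nu>"
    by (auto simp: MN_def set_mult_def)
  obtain u where "cmod u = 1" "m *v axis None 1 = u *s axis None 1"
      "m *v axis (Some p) 1 = u *s axis (Some p) 1"
    using m by (auto simp: Mgrp_iff)
  then have "cmod u = 1 \<and> m *v null_vec p = u *s null_vec p"
    by (simp add: null_vec_def matrix_vector_right_distrib)
  then show "g \<in> {g \<in> carrier U1n. \<exists>u. cmod u = 1 \<and> g *v null_vec p = u *s null_vec p}"
    using Ngrp_U1n[OF \<nu>] m
    by (auto simp: g Mgrp_iff matrix_mult_in_U1n simp flip: matrix_vector_mul_assoc)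
next
  fix g assume "g \<in> {g \<in> carrier U1n. \<exists>u. cmod u = 1 \<and> g *v null_vec p = u *s null_vec p}"
  then obtain u where g: "g \<in> carrier U1n" and u: "cmod u = 1" and gv: "g *v null_vec p = u *s null_vec p"
    by auto
  have uu: "u * cnj u = 1"
    using u complex_norm_square[of u] by simp
  define z where "z = u *s (matrix_inv g *v axis None 1)"
  have gz: "g *v z = u *s axis None 1"
    by (simp add: z_def vector_scalar_commute g)
  have "herm z z = -1"
    using uu herm_U1n[OF g, of z z] by (simp add: gz herm_simps)
  moreover have "herm (null_vec p) z = -1"
    using uu herm_U1n[OF g, of "null_vec p" z]
    by (simp add: gz gv herm_simps herm_null_vec axis_def mult.commute)
  ultimately obtain \<nu> where \<nu>: "\<nu> \<in> Ngrp p" "\<nu> *v axis None 1 = z"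
    using Ngrp_transitive by blast
  obtain \<nu>' where \<nu>': "\<nu>' \<in> Ngrp p" "\<nu> ** \<nu>' = mat 1"
    using Ngrp_inverse[OF \<nu>(1)] by blast
  have "(g ** \<nu>) *v axis None 1 = u *s axis None 1"
    by (simp add: \<nu>(2) gz flip: matrix_vector_mul_assoc)
  moreover have "(g ** \<nu>) *v null_vec p = u *s null_vec p"
    by (simp add: Ngrp_U1n(2)[OF \<nu>(1)] gv flip: matrix_vector_mul_assoc)
  ultimately have "(g ** \<nu>) *v axis (Some p) 1 = u *s axis (Some p) 1"
    by (simp add: null_vec_def matrix_vector_right_distrib)
  then have "g ** \<nu> \<in> Mgrp p"
    using \<open>(g ** \<nu>) *v axis None 1 = u *s axis None 1\<close> u g Ngrp_U1n(1)[OF \<nu>(1)]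
    by (auto simp: Mgrp_iff matrix_mult_in_U1n)
  moreover have "g = (g ** \<nu>) ** \<nu>'"
    by (simp add: \<nu>'(2) flip: matrix_mul_assoc)
  ultimately show "g \<in> MN p"
    unfolding MN_def set_mult_def using \<nu>'(1) by auto
qed

abbreviation horo_coset ::
  "'n::finite \<Rightarrow> complex ^ 'n option ^ 'n option \<Rightarrow> (complex ^ 'n option ^ 'n option) set" where
  "horo_coset p g \<equiv> g <#\<^bsub>U1n\<^esub> MN p"

lemma mem_horo_coset:
  assumes "c \<in> carrier U1n"
  shows "c' \<in> horo_coset p c \<longleftrightarrow>
    c' \<in> carrier U1n \<and> (\<exists>u. cmod u = 1 \<and> c' *v null_vec p = u *s (c *v null_vec p))"
proof
  assume "c' \<in> horo_coset p c"
  then show "c' \<in> carrier U1n \<and> (\<exists>u. cmod u = 1 \<and> c' *v null_vec p = u *s (c *v null_vec p))"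
    using assms
    by (auto simp: l_coset_def MN_eq matrix_mult_in_U1n vector_scalar_commute
        simp flip: matrix_vector_mul_assoc)
next
  assume c': "c' \<in> carrier U1n \<and> (\<exists>u. cmod u = 1 \<and> c' *v null_vec p = u *s (c *v null_vec p))"
  then have "matrix_inv c ** c' \<in> MN p"
    using assms matrix_inv_U1n(3)[OF assms]
    by (auto simp: MN_eq matrix_mult_in_U1n vector_scalar_commute simp flip: matrix_vector_mul_assoc)
  moreover have "c' = c ** (matrix_inv c ** c')"
    by (simp add: matrix_mul_assoc matrix_inv_U1n(2)[OF assms])
  ultimately show "c' \<in> horo_coset p c"
    by (auto simp: l_coset_def)
qed

lemma horo_coset_self: "c \<in> carrier U1n \<Longrightarrow> c \<in> horo_coset p c"
  by (auto simp: mem_horo_coset intro: exI[of _ 1])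

lemma horo_coset_eqI:
  assumes "c \<in> carrier U1n" "c' \<in> carrier U1n" "cmod u = 1"
    and "c' *v null_vec p = u *s (c *v null_vec p)"
  shows "horo_coset p c' = horo_coset p c"
proof -
  have "u \<noteq> 0"
    using assms(3) by auto
  have "(\<exists>w. cmod w = 1 \<and> x = w *s (u *s y)) \<longleftrightarrow> (\<exists>w. cmod w = 1 \<and> x = w *s y)"
    for x y :: "complex ^ 'a option"
  proof safe
    fix w assume "cmod w = 1"
    then show "\<exists>w'. cmod w' = 1 \<and> w *s (u *s y) = w' *s y"
      by (intro exI[of _ "w * u"]) (simp add: norm_mult assms(3))
    show "\<exists>w'. cmod w' = 1 \<and> w *s y = w' *s (u *s y)"
      using \<open>cmod w = 1\<close> \<open>u \<noteq> 0\<close>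
      by (intro exI[of _ "w / u"]) (simp add: norm_divide assms(3))
  qed
  then show ?thesis
    by (auto simp: mem_horo_coset assms(1,2) assms(4))
qed

lemma translate_horo_coset:
  "g <#\<^bsub>U1n\<^esub> horo_coset p c = horo_coset p (g ** c)"
  by (auto simp: l_coset_def matrix_mul_assoc)

section \<open>Points on horospheres\<close>

lemma mem_proj [simp]: "z \<in> proj z"
  by (auto simp: proj_def intro: exI[of _ 1])

lemma proj_eq_iff: "proj z = proj w \<longleftrightarrow> (\<exists>c. c \<noteq> 0 \<and> z = c *s w)"
proof
  assume "proj z = proj w"
  then have "z \<in> proj w"
    using mem_proj[of z] by simp
  then show "\<exists>c. c \<noteq> 0 \<and> z = c *s w"
    by (auto simp: proj_def)
next
  assume "\<exists>c. c \<noteq> 0 \<and> z = c *s w"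
  then obtain c where c: "c \<noteq> 0" "z = c *s w"
    by auto
  show "proj z = proj w"
  proof (rule Set.set_eqI)
    fix x
    show "x \<in> proj z \<longleftrightarrow> x \<in> proj w"
      unfolding proj_def using c
      by auto (metis divide_eq_0_iff nonzero_mult_div_cancel_right times_divide_eq_left)
  qed
qed

lemma act_proj [simp]: "act g (proj z) = proj (g *v z)"
proof -
  have "(*v) g ` {c *s z |c. c \<noteq> 0} = {g *v (c *s z) |c. c \<noteq> 0}"
    by blast
  then show ?thesis
    by (simp add: act_def proj_def vector_scalar_commute)
qed

lemma act_act: "act g (act h X) = act (g ** h) X"
  by (auto simp: act_def image_iff matrix_vector_mul_assoc)

text \<open>
  Translating by \<open>c\<close> and rescaling reduces the claim to the base horosphere, which consists of the lines
  through the vectors \<open>\<nu> e\<^sub>0\<close>. These are the vectors described in \<open>Ngrp_transitive\<close>; a phase and a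
  positive factor suffice to arrange the two normalizations there.
\<close>

lemma proj_mem_horosphere:
  assumes c: "c \<in> carrier U1n" and z: "Re (herm z z) < 0"
  shows "proj z \<in> horosphere p (horo_coset p c) \<longleftrightarrow>
    (cmod (herm z (c *v null_vec p)))\<^sup>2 = - Re (herm z z)"
proof
  assume "proj z \<in> horosphere p (horo_coset p c)"
  then obtain g \<nu> where g: "g \<in> horo_coset p c" and \<nu>: "\<nu> \<in> Ngrp p"
    and "proj z = act g (act \<nu> origin)"
    by (auto simp: horosphere_def base_horosphere_def)
  then have "proj z = proj (g *v (\<nu> *v axis None 1))"
    by (simp add: origin_def)
  then obtain l where zl: "z = l *s (g *v (\<nu> *v axis None 1))"
    unfolding proj_eq_iff by blast
  obtain u where gG: "g \<in> carrier U1n" and u: "cmod u = 1" and gu: "g *v null_vec p = u *s (c *v null_vec p)"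
    using g by (auto simp: mem_horo_coset[OF c])
  note \<nu>' = Ngrp_U1n[OF \<nu>]
  have "herm z z = cnj l * l * - 1"
    unfolding zl by (simp add: herm_simps herm_U1n[OF gG] herm_U1n[OF \<nu>'(1)])
  then have 1: "- Re (herm z z) = (cmod l)\<^sup>2"
    using complex_norm_square[of l]
    by (metis Re_complex_of_real mult.commute mult_minus1_right minus_minus uminus_complex.sel(1))
  have "u * herm z (c *v null_vec p) = herm z (g *v (\<nu> *v null_vec p))"
    by (simp add: \<nu>'(2) gu herm_simps)
  also have "\<dots> = - cnj l"
    unfolding zl by (simp add: herm_simps herm_U1n[OF gG] herm_U1n[OF \<nu>'(1)])
  finally have "cmod (u * herm z (c *v null_vec p)) = cmod l"
    by simp
  then show "(cmod (herm z (c *v null_vec p)))\<^sup>2 = - Re (herm z z)"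
    using u 1 by (simp add: norm_mult)
next
  define a where "a = herm z (c *v null_vec p)"
  assume "(cmod (herm z (c *v null_vec p)))\<^sup>2 = - Re (herm z z)"
  then have "(of_real (Re (herm z z)) :: complex) = - (a * cnj a)"
    using complex_norm_square[of a] unfolding a_def by (metis minus_minus of_real_minus)
  then have zz: "herm z z = - (a * cnj a)"
    by simp
  have a: "a \<noteq> 0"
    using zz z by auto
  \<comment> \<open>The factor that turns the product with \<open>c v\<^sub>0\<close> into \<open>-1\<close>; the norm becomes \<open>-1\<close> at the same time.\<close>
  define l where "l = - 1 / cnj a"
  have l: "l \<noteq> 0" "cnj l * l * (a * cnj a) = 1" "l * cnj a = -1"
    using a by (simp_all add: l_def)
  define w where "w = matrix_inv c *v (l *s z)"
  have cw: "c *v w = l *s z"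
    by (simp add: w_def c)
  have "herm w w = - (cnj l * l * (a * cnj a))"
    using herm_U1n[OF c, of w w] by (simp add: cw herm_simps zz mult_ac)
  then have "herm w w = -1"
    by (simp only: l)
  moreover have "herm (null_vec p) w = -1"
  proof -
    have "herm (null_vec p) w = l * herm (c *v null_vec p) z"
      using herm_U1n[OF c, of "null_vec p" w] by (simp add: cw herm_scale_right)
    also have "herm (c *v null_vec p) z = cnj a"
      by (simp add: a_def cnj_herm)
    finally show ?thesis
      by (simp only: l)
  qed
  ultimately obtain \<nu> where \<nu>: "\<nu> \<in> Ngrp p" "\<nu> *v axis None 1 = w"
    using Ngrp_transitive by blast
  have "act c (act \<nu> origin) = proj (l *s z)"
    by (simp add: origin_def \<nu>(2) cw)
  also have "\<dots> = proj z"
    unfolding proj_eq_iff using l(1) by blast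
  finally show "proj z \<in> horosphere p (horo_coset p c)"
    using \<nu>(1) horo_coset_self[OF c, of p]
    unfolding horosphere_def base_horosphere_def by blast
qed

section \<open>Geodesics\<close>

lemma normalize_negative:
  assumes "Re (herm y y) < 0"
  obtains l r where "l \<noteq> 0" "1 \<le> r" "herm (l *s y) (l *s y) = -1" "(l *s y) $ None = of_real r"
proof -
  define \<rho> where "\<rho> = sqrt (- Re (herm y y))"
  have \<rho>: "\<rho> > 0" "\<rho>\<^sup>2 = - Re (herm y y)"
    using assms by (simp_all add: \<rho>_def)
  have ge: "(cmod (y $ None))\<^sup>2 \<ge> \<rho>\<^sup>2"
    unfolding \<rho>(2) by (simp add: herm_self sum_nonneg del: of_real_sum)
  then have y0: "cmod (y $ None) \<ge> \<rho>"
    using \<rho>(1) power2_le_imp_le norm_ge_zero by blast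
  define l where "l = cnj (y $ None) / of_real (cmod (y $ None) * \<rho>)"
  have "y $ None \<noteq> 0"
    using y0 \<rho>(1) by auto
  then have l: "cmod l = 1 / \<rho>" "l \<noteq> 0"
    using \<rho>(1) by (simp_all add: l_def norm_divide norm_mult)
  have yy: "herm y y = - of_real (\<rho>\<^sup>2)"
    unfolding \<rho>(2) by simp
  have "herm (l *s y) (l *s y) = of_real ((cmod l)\<^sup>2) * herm y y"
    unfolding complex_norm_square by (simp add: herm_simps)
  also have "\<dots> = -1"
    using \<rho>(1) by (simp add: l yy power_divide)
  finally have 1: "herm (l *s y) (l *s y) = -1" .
  have "(l *s y) $ None = of_real ((cmod (y $ None))\<^sup>2) / of_real (cmod (y $ None) * \<rho>)"
    unfolding complex_norm_square by (simp add: l_def)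
  also have "\<dots> = of_real (cmod (y $ None) / \<rho>)"
    by (simp add: power2_eq_square)
  finally have "(l *s y) $ None = of_real (cmod (y $ None) / \<rho>)" .
  moreover have "1 \<le> cmod (y $ None) / \<rho>"
    using y0 \<rho>(1) by simp
  ultimately show ?thesis
    using that l(2) 1 by blast
qed

lemma complex_hyperbolic_cases:
  assumes "X \<in> complex_hyperbolic"
  obtains x r where "X = proj x" "1 \<le> r" "herm x x = -1" "x $ None = of_real r"
proof -
  obtain y where y: "X = proj y" "Re (herm y y) < 0"
    using assms by (auto simp: complex_hyperbolic_def)
  obtain l r where l: "l \<noteq> 0" and r: "1 \<le> r" "herm (l *s y) (l *s y) = -1" "(l *s y) $ None = of_real r"
    using normalize_negative[OF y(2)] by blast
  have "X = proj (l *s y)"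
    unfolding y(1) proj_eq_iff using l by (intro exI[of _ "1 / l"]) simp
  then show ?thesis
    using r that by blast
qed

lemma proj_complex_hyperbolic: "herm x x = -1 \<Longrightarrow> proj x \<in> complex_hyperbolic"
  by (auto simp: complex_hyperbolic_def)

lemma act_complex_hyperbolic:
  assumes "g \<in> carrier U1n" "X \<in> complex_hyperbolic"
  shows "act g X \<in> complex_hyperbolic"
proof -
  obtain x r where x: "X = proj x" "herm x x = -1"
    using complex_hyperbolic_cases[OF assms(2)] by metis
  then show ?thesis
    using proj_complex_hyperbolic[of "g *v x"] herm_U1n[OF assms(1), of x x] by simp
qed

text \<open>
  The first point is moved to the origin by a reflection and the second one onto the standard geodesic by
  an element fixing \<open>e\<^sub>0\<close>.
\<close>

lemma two_point_homogeneous: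
  assumes "X \<in> complex_hyperbolic" "Y \<in> complex_hyperbolic"
  obtains g d where "g \<in> carrier U1n" "0 \<le> d"
    "X = proj (g *v geo p 0)" "Y = proj (g *v geo p d)"
proof -
  obtain x r where x: "X = proj x" "1 \<le> r" "herm x x = -1" "x $ None = of_real r"
    using complex_hyperbolic_cases[OF assms(1)] by metis
  \<comment> \<open>The representative with negative first component: with the positive one, the reflection
    taking \<open>e\<^sub>0\<close> to \<open>x\<close> degenerates when \<open>x = e\<^sub>0\<close>.\<close>
  define x' where "x' = (-1) *s x"
  have X: "X = proj x'"
    unfolding x(1) proj_eq_iff x'_def by (intro exI[of _ "-1"]) simp
  have "herm (axis None 1 - x') (axis None 1) = - 1 - of_real r"
    by (simp add: herm_simps x'_def x(4))
  also have "\<dots> = - of_real (1 + r)"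
    by simp
  also have "\<dots> \<noteq> 0"
    using x(2) unfolding neg_equal_0_iff_equal of_real_eq_0_iff by simp
  finally have "herm (axis None 1 - x') (axis None 1) \<noteq> 0" .
  moreover have "herm (axis None 1) (axis None 1) = herm x' x'"
    unfolding x'_def herm_simps by (simp add: x(3))
  ultimately obtain g where g: "g \<in> carrier U1n" "g *v axis None 1 = x'"
    using ex_U1n_mapsto by metis
  have "act (matrix_inv g) Y \<in> complex_hyperbolic"
    using act_complex_hyperbolic assms(2) g(1) matrix_inv_U1n(3) by blast
  then obtain y t where y: "act (matrix_inv g) Y = proj y" "1 \<le> t" "herm y y = -1" "y $ None = of_real t"
    using complex_hyperbolic_cases by metis
  define d where "d = arcosh t"
  have d: "0 \<le> d" "cosh d = t"
    using y(2) by (simp_all add: d_def arcosh_nonneg_real cosh_arcosh_real)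
  have "herm (geo p d) (geo p d) = herm y y" "geo p d $ None = y $ None"
    using y d by (simp_all add: herm_geo)
  then obtain k where k: "k \<in> carrier U1n" "k *v geo p d = y" "k *v axis None 1 = axis None 1"
    using ex_stabilizer_mapsto by metis
  show ?thesis
  proof
    show "g ** k \<in> carrier U1n"
      using g k by (simp add: matrix_mult_in_U1n)
    show "0 \<le> d"
      by (rule d)
    show "X = proj ((g ** k) *v geo p 0)"
      by (simp add: X k(3) g(2) flip: matrix_vector_mul_assoc)
    have "act g (act (matrix_inv g) Y) = Y"
      unfolding act_act matrix_inv_U1n(2)[OF g(1)] by (simp add: act_def)
    then show "Y = proj ((g ** k) *v geo p d)"
      by (simp add: y(1) k(2) flip: matrix_vector_mul_assoc)
  qed
qed

lemma cmod_herm_quotient: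
  assumes "g \<in> carrier U1n" "x \<in> proj (g *v geo p s)" "y \<in> proj (g *v geo p t)"
  shows "cmod (herm x y) / sqrt (Re (herm x x) * Re (herm y y)) = cosh (t - s)"
proof -
  obtain c c' where c: "c \<noteq> 0" "x = c *s (g *v geo p s)" and c': "c' \<noteq> 0" "y = c' *s (g *v geo p t)"
    using assms(2,3) by (auto simp: proj_def)
  have xy: "herm x y = - (cnj c * c' * of_real (cosh (t - s)))"
    unfolding c c' herm_simps herm_U1n[OF assms(1)] herm_geo by simp
  have "herm x x = - of_real ((cmod c)\<^sup>2)" "herm y y = - of_real ((cmod c')\<^sup>2)"
    unfolding c c' herm_simps herm_U1n[OF assms(1)] herm_geo complex_norm_square by simp_all
  then have "Re (herm x x) * Re (herm y y) = (cmod c * cmod c')\<^sup>2"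
    by (simp add: power_mult_distrib del: of_real_power)
  then have "sqrt (Re (herm x x) * Re (herm y y)) = cmod c * cmod c'"
    by (simp add: real_sqrt_mult)
  then show ?thesis
    using c(1) c'(1) by (simp add: xy norm_mult)
qed

lemma hdist_geo:
  assumes "g \<in> carrier U1n"
  shows "hdist (proj (g *v geo p s)) (proj (g *v geo p t)) = \<bar>t - s\<bar>"
  unfolding hdist_def
proof (rule the_equality)
  show "0 \<le> \<bar>t - s\<bar> \<and> (\<forall>x\<in>proj (g *v geo p s). \<forall>y\<in>proj (g *v geo p t).
      cosh \<bar>t - s\<bar> = cmod (herm x y) / sqrt (Re (herm x x) * Re (herm y y)))"
    using cmod_herm_quotient[OF assms] by auto
  fix d :: real
  assume d: "0 \<le> d \<and> (\<forall>x\<in>proj (g *v geo p s). \<forall>y\<in>proj (g *v geo p t).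
      cosh d = cmod (herm x y) / sqrt (Re (herm x x) * Re (herm y y)))"
  then have "cosh d = cosh (t - s)"
    using cmod_herm_quotient[OF assms] mem_proj by metis
  then show "d = \<bar>t - s\<bar>"
    using d by simp
qed

text \<open>
  By homogeneity the quotient is a value of \<open>cosh\<close>, which supplies the reverse Cauchy-Schwarz inequality
  on which the description of the distance as a unique number rests.
\<close>

lemma cosh_hdist:
  assumes "X \<in> complex_hyperbolic" "Y \<in> complex_hyperbolic" "x \<in> X" "y \<in> Y"
  shows "cosh (hdist X Y) = cmod (herm x y) / sqrt (Re (herm x x) * Re (herm y y))"
proof -
  obtain g d where g: "g \<in> carrier U1n" "0 \<le> d"
    "X = proj (g *v geo undefined 0)" "Y = proj (g *v geo undefined d)"
    using two_point_homogeneous[OF assms(1,2)] by metis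
  then show ?thesis
    using cmod_herm_quotient[OF g(1), of x undefined 0 y d] assms(3,4)
      hdist_geo[OF g(1), of undefined 0 d] by simp
qed

text \<open>
  Equality in the triangle inequality: the distance conditions bound the real part of
  \<open>\<langle>w, geo p s\<rangle>\<close> from below by \<open>-1\<close>, so the difference of the two vectors, which is orthogonal to
  \<open>e\<^sub>0\<close>, has norm at most \<open>0\<close>, and there the form is positive definite.
\<close>

lemma geo_unique:
  assumes w: "herm w w = -1" "w $ None = of_real r" "1 \<le> r" and s: "0 \<le> s" "s \<le> d"
    and 0: "cmod (herm (axis None 1) w) = cosh s"
    and d: "cmod (herm w (geo p d)) = cosh (d - s)"
  shows "w = geo p s"
proof -
  have r: "r = cosh s"
    using 0 w by simp
  have herm_w: "Re (herm w (geo p t)) = sinh t * Re (w $ Some p) - cosh t * cosh s" for t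
    by (simp add: geo_def herm_simps w r)
  have "- Re (herm w (geo p d)) \<le> cosh (d - s)"
    using abs_Re_le_cmod[of "herm w (geo p d)"] d by linarith
  then have *: "sinh d * sinh s \<le> sinh d * Re (w $ Some p)"
    by (simp add: herm_w cosh_diff mult.commute)
  have "sinh s * sinh s \<le> sinh s * Re (w $ Some p)"
  proof (cases "s = 0")
    case False
    then have "0 < sinh d"
      using s by simp
    then have "sinh s \<le> Re (w $ Some p)"
      using * by simp
    then show ?thesis
      using s by (intro mult_left_mono) auto
  qed simp
  moreover have "Re (herm (w - geo p s) (w - geo p s)) = - 2 - 2 * Re (herm w (geo p s))"
  proof -
    have "herm (geo p s) w = cnj (herm w (geo p s))"
      by (simp add: cnj_herm)
    then show ?thesis
      by (simp add: herm_simps w herm_geo)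
  qed
  ultimately have "Re (herm (w - geo p s) (w - geo p s)) \<le> 0"
    using cosh_square_eq[of s] by (simp add: herm_w power2_eq_square)
  moreover have None: "(w - geo p s) $ None = 0"
    by (simp add: w r)
  then have "0 \<le> Re (herm (w - geo p s) (w - geo p s))"
    by (subst herm_self) (simp add: sum_nonneg del: of_real_sum of_real_power)
  ultimately have "herm (w - geo p s) (w - geo p s) = 0"
    by (simp add: complex_eq_iff)
  then show ?thesis
    using herm_spatial_eq_0[OF None] by simp
qed

lemma geodesic_segment_geo:
  assumes g: "g \<in> carrier U1n" and d: "0 \<le> d"
  shows "geodesic_segment (proj (g *v geo p 0)) (proj (g *v geo p d))
    = (\<lambda>s. proj (g *v geo p s)) ` {0..d}"
proof -
  let ?\<gamma> = "\<lambda>s. proj (g *v geo p s)"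
  have hd: "hdist (?\<gamma> 0) (?\<gamma> d) = d"
    using d by (simp add: hdist_geo[OF g] del: geo_0)
  have "?\<gamma> s \<in> complex_hyperbolic" for s
    by (rule proj_complex_hyperbolic) (simp add: herm_U1n[OF g] herm_geo)
  then have path: "geodesic_path (?\<gamma> 0) (?\<gamma> d) ?\<gamma>"
    unfolding geodesic_path_def hd by (auto simp: hdist_geo[OF g])
  have unique: "\<gamma> s = ?\<gamma> s" if \<gamma>: "geodesic_path (?\<gamma> 0) (?\<gamma> d) \<gamma>" and s: "s \<in> {0..d}" for \<gamma> s
  proof -
    have \<gamma>0: "\<gamma> 0 = ?\<gamma> 0" "\<gamma> d = ?\<gamma> d" and \<gamma>_in: "\<And>s. s \<in> {0..d} \<Longrightarrow> \<gamma> s \<in> complex_hyperbolic"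
      and dist: "\<And>s t. s \<in> {0..d} \<Longrightarrow> t \<in> {0..d} \<Longrightarrow> hdist (\<gamma> s) (\<gamma> t) = \<bar>s - t\<bar>"
      using \<gamma> unfolding geodesic_path_def hd by auto
    let ?g' = "matrix_inv g"
    have "act ?g' (\<gamma> s) \<in> complex_hyperbolic"
      using act_complex_hyperbolic matrix_inv_U1n(3)[OF g] \<gamma>_in[OF s] by blast
    then obtain w r where w: "act ?g' (\<gamma> s) = proj w" "1 \<le> r" "herm w w = -1" "w $ None = of_real r"
      using complex_hyperbolic_cases by metis
    have "\<gamma> s = act g (act ?g' (\<gamma> s))"
      unfolding act_act matrix_inv_U1n(2)[OF g] by (simp add: act_def)
    then have \<gamma>s: "\<gamma> s = proj (g *v w)"
      by (simp add: w(1))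
    have "cosh s = cmod (herm (axis None 1) w)"
      using cosh_hdist[OF \<gamma>_in \<gamma>_in, of 0 s "g *v geo p 0" "g *v w"] dist[of 0 s] s
      by (simp add: \<gamma>0 \<gamma>s herm_U1n[OF g] w(3))
    moreover have "cosh (d - s) = cmod (herm w (geo p d))"
      using cosh_hdist[OF \<gamma>_in \<gamma>_in, of s d "g *v w" "g *v geo p d"] dist[of s d] s
      by (simp add: \<gamma>0 \<gamma>s herm_U1n[OF g] w(3) herm_geo)
    ultimately have "w = geo p s"
      using w s by (intro geo_unique[of w r s d p]) auto
    then show ?thesis
      using \<gamma>s by simp
  qed
  have "\<gamma> ` {0..d} = ?\<gamma> ` {0..d}" if "geodesic_path (?\<gamma> 0) (?\<gamma> d) \<gamma>" for \<gamma>
    using unique[OF that] by (intro image_cong refl)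
  then show ?thesis
    unfolding geodesic_segment_def hd using path by blast
qed

section \<open>Crossing times\<close>

text \<open>
  The definition speaks of cosets rather than of null vectors so as to make sense on the measure space
  without a choice of representatives.
\<close>

definition crosses ::
  "'n::finite \<Rightarrow> complex ^ 'n option ^ 'n option \<Rightarrow> real \<Rightarrow> (complex ^ 'n option ^ 'n option) set \<Rightarrow> bool"
  where "crosses p g s C \<longleftrightarrow> (\<exists>c\<in>C. cmod (herm (g *v geo p s) (c *v null_vec p)) = 1)"

lemma crosses_horo_coset:
  assumes "c \<in> carrier U1n"
  shows "crosses p g s (horo_coset p c) \<longleftrightarrow> cmod (herm (g *v geo p s) (c *v null_vec p)) = 1"
proof
  assume "cmod (herm (g *v geo p s) (c *v null_vec p)) = 1"
  then show "crosses p g s (horo_coset p c)"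
    using horo_coset_self[OF assms] unfolding crosses_def by blast
next
  assume "crosses p g s (horo_coset p c)"
  then show "cmod (herm (g *v geo p s) (c *v null_vec p)) = 1"
    by (auto simp: crosses_def mem_horo_coset[OF assms] herm_simps norm_mult)
qed

lemma crosses_translate:
  assumes "g \<in> carrier U1n" "c \<in> carrier U1n"
  shows "crosses p (g ** h) s (horo_coset p (g ** c)) \<longleftrightarrow> crosses p h s (horo_coset p c)"
  using assms
  by (simp add: crosses_horo_coset matrix_mult_in_U1n herm_U1n flip: matrix_vector_mul_assoc)

lemma crosses_boost: "crosses p (g ** boost p t) s C \<longleftrightarrow> crosses p g (t + s) C"
  by (simp add: crosses_def boost_geo flip: matrix_vector_mul_assoc)

text \<open>
  Multiplying the square of the modulus by \<open>x = exp (2 s)\<close> gives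
  \<open>|a|\<^sup>2 x\<^sup>2 + (2 Re (a cnj b) - 1) x + |b|\<^sup>2 = 0\<close>. If the outer coefficients vanish, the middle one
  is \<open>-1\<close>, so the polynomial is never zero.
\<close>

lemma card_exp_combination_le_2:
  fixes a b :: complex
  defines "S \<equiv> {s. cmod (of_real (exp s) * a + of_real (exp (- s)) * b) = 1}"
  shows "finite S" and "card S \<le> 2"
proof -
  define q where "q = [:(cmod b)\<^sup>2, 2 * Re (a * cnj b) - 1, (cmod a)\<^sup>2:]"
  have q: "q \<noteq> 0"
    by (auto simp: q_def)
  have inj: "inj_on (\<lambda>s::real. exp (2 * s)) S"
    by (auto intro: inj_onI)
  have sub: "(\<lambda>s. exp (2 * s)) ` S \<subseteq> {x. poly q x = 0}"
  proof safe
    fix s assume "s \<in> S"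
    then have 1: "cmod (of_real (exp s) * a + of_real (exp (- s)) * b) = 1"
      by (simp add: S_def)
    have "of_real (exp (2 * s)) * a + b = of_real (exp s) * (of_real (exp s) * a + of_real (exp (- s)) * b)"
    proof -
      have "(of_real (exp (2 * s)) :: complex) = of_real (exp s) * of_real (exp s)"
        unfolding of_real_mult[symmetric] exp_double by (simp add: power2_eq_square)
      moreover have "(of_real (exp s) :: complex) * of_real (exp (- s)) = 1"
        unfolding of_real_mult[symmetric] by (simp add: exp_minus)
      ultimately show ?thesis
        by (simp only: distrib_left mult.assoc[symmetric] mult_1_left)
    qed
    then have "(cmod (of_real (exp (2 * s)) * a + b))\<^sup>2 = exp (2 * s)"
      using 1 by (simp add: norm_mult power_mult_distrib exp_double)
    moreover have "(cmod (of_real x * a + b))\<^sup>2 = x\<^sup>2 * (cmod a)\<^sup>2 + 2 * x * Re (a * cnj b) + (cmod b)\<^sup>2"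
      for x :: real
      unfolding cmod_power2 by (simp add: power2_eq_square algebra_simps)
    ultimately show "poly q (exp (2 * s)) = 0"
      by (simp add: q_def power2_eq_square algebra_simps)
  qed
  show "finite S"
    using finite_subset[OF sub poly_roots_finite[OF q]] finite_imageD[OF _ inj] by blast
  have "card S \<le> card {x. poly q x = 0}"
    using card_mono[OF poly_roots_finite[OF q] sub] card_image[OF inj] by simp
  also have "\<dots> \<le> degree q"
    using card_poly_roots_bound[OF q] .
  also have "\<dots> \<le> 2"
    by (simp add: q_def)
  finally show "card S \<le> 2" .
qed

definition crossing_times ::
  "'n::finite \<Rightarrow> complex ^ 'n option ^ 'n option \<Rightarrow> real \<Rightarrow> (complex ^ 'n option ^ 'n option) set \<Rightarrow> real set"
  where "crossing_times p g d C = {s \<in> {0..d}. crosses p g s C}"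

lemma crossing_times_bound:
  assumes "c \<in> carrier U1n"
  shows "finite (crossing_times p g d (horo_coset p c))"
    and "card (crossing_times p g d (horo_coset p c)) \<le> 2"
proof -
  define A B where "A = herm (g *v axis None 1) (c *v null_vec p)"
    and "B = herm (g *v axis (Some p) 1) (c *v null_vec p)"
  let ?S = "{s. cmod (of_real (exp s) * ((A + B) / 2) + of_real (exp (- s)) * ((A - B) / 2)) = 1}"
  have "herm (g *v geo p s) (c *v null_vec p)
      = of_real (exp s) * ((A + B) / 2) + of_real (exp (- s)) * ((A - B) / 2)" for s
  proof -
    have "herm (g *v geo p s) (c *v null_vec p) = of_real (cosh s) * A + of_real (sinh s) * B"
      by (simp add: geo_def matrix_vector_right_distrib vector_scalar_commute herm_simps A_def B_def)
    then show ?thesis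
      by (simp add: cosh_field_def sinh_field_def field_simps)
  qed
  then have "crossing_times p g d (horo_coset p c) \<subseteq> ?S"
    by (auto simp: crossing_times_def crosses_horo_coset[OF assms])
  then show "finite (crossing_times p g d (horo_coset p c))"
    "card (crossing_times p g d (horo_coset p c)) \<le> 2"
    using card_exp_combination_le_2[of "(A + B) / 2" "(A - B) / 2"]
    by (meson finite_subset card_mono le_trans)+
qed

text \<open>
  The geodesic is injective, so counting the points of intersection is counting their parameters.
\<close>

lemma meets_eq_card:
  assumes g: "g \<in> carrier U1n" and d: "0 \<le> d" and c: "c \<in> carrier U1n"
  shows "meets p (proj (g *v geo p 0)) (proj (g *v geo p d)) (horo_coset p c)
    = of_nat (card (crossing_times p g d (horo_coset p c)))"
proof -
  let ?\<gamma> = "\<lambda>s. proj (g *v geo p s)" and ?T = "crossing_times p g d (horo_coset p c)"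
  have neg: "herm (g *v geo p s) (g *v geo p s) = -1" for s
    by (simp add: herm_U1n[OF g] herm_geo)
  have "?\<gamma> s \<in> horosphere p (horo_coset p c) \<longleftrightarrow> crosses p g s (horo_coset p c)" for s
    using proj_mem_horosphere[OF c, of "g *v geo p s" p] norm_ge_zero[of "herm (g *v geo p s) (c *v null_vec p)"]
    by (auto simp: neg crosses_horo_coset[OF c] power2_eq_1_iff simp del: norm_ge_zero)
  then have "horosphere p (horo_coset p c) \<inter> geodesic_segment (?\<gamma> 0) (?\<gamma> d) = ?\<gamma> ` ?T"
    unfolding geodesic_segment_geo[OF g d] crossing_times_def by auto
  moreover have "inj_on ?\<gamma> ?T"
  proof (rule inj_onI)
    fix s t assume "s \<in> ?T" "t \<in> ?T" and eq: "?\<gamma> s = ?\<gamma> t"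
    show "s = t"
      using hdist_geo[OF g, of p s t] hdist_geo[OF g, of p s s] eq by simp
  qed
  ultimately show ?thesis
    using crossing_times_bound(1)[OF c]
    by (simp add: meets_def emeasure_count_space_finite card_image)
qed

section \<open>The topology of the space of horospheres\<close>

lemma topspace_horosphere_space_image: "topspace (horosphere_space p) = horo_coset p ` carrier U1n"
  by (simp add: horosphere_space_def)

lemma horosphere_space_cases:
  assumes "C \<in> topspace (horosphere_space p)"
  obtains c where "c \<in> carrier U1n" "C = horo_coset p c"
  using assms by (auto simp: topspace_horosphere_space_image)

lemma continuous_map_horo_coset:
  "continuous_map (top_of_set (carrier U1n)) (horosphere_space p) (horo_coset p)"
  unfolding horosphere_space_def
  by (rule quotient_imp_continuous_map[OF quotient_map_quotient_topology])

lemma openin_horosphere_spaceI: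
  assumes "open V" and "\<And>c. c \<in> carrier U1n \<Longrightarrow> R (horo_coset p c) \<longleftrightarrow> c \<in> V"
  shows "openin (horosphere_space p) {C \<in> topspace (horosphere_space p). R C}"
proof -
  have "{c \<in> carrier U1n. horo_coset p c \<in> {C \<in> topspace (horosphere_space p). R C}} = carrier U1n \<inter> V"
    using assms(2) by (auto simp: topspace_horosphere_space_image)
  moreover have "openin (top_of_set (carrier U1n)) (carrier U1n \<inter> V)"
    using assms(1) by (rule openin_open_Int)
  moreover have "{C \<in> topspace (horosphere_space p). R C} \<subseteq> topspace (horosphere_space p)"
    by blast
  ultimately show ?thesis
    by (simp add: horosphere_space_def openin_quotient_topology del: topspace_horosphere_space_image)
qed

lemma closedin_horosphere_spaceI:
  assumes "closed V" and "\<And>c. c \<in> carrier U1n \<Longrightarrow> R (horo_coset p c) \<longleftrightarrow> c \<in> V"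
  shows "closedin (horosphere_space p) {C \<in> topspace (horosphere_space p). R C}"
proof -
  have "openin (horosphere_space p) {C \<in> topspace (horosphere_space p). \<not> R C}"
    using assms by (intro openin_horosphere_spaceI[of "- V"]) auto
  moreover have "topspace (horosphere_space p) - {C \<in> topspace (horosphere_space p). R C}
      = {C \<in> topspace (horosphere_space p). \<not> R C}"
    by blast
  ultimately show ?thesis
    by (auto simp: closedin_def)
qed

lemma continuous_on_herm_geo:
  "continuous_on UNIV (\<lambda>(s, c). herm (g *v geo p s) (c *v v))"
  unfolding split_def herm_def matrix_vector_mult_def geo_def
  by (simp, intro continuous_intros)

lemma continuous_on_herm_mult:
  "continuous_on UNIV (\<lambda>c. herm (c *v z) (c *v w))"
  "continuous_on UNIV (\<lambda>c. herm z (c *v w))"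
  unfolding herm_def matrix_vector_mult_def by (simp_all, (intro continuous_intros)+)

definition hits ::
  "'n::finite \<Rightarrow> complex ^ 'n option ^ 'n option \<Rightarrow> real \<Rightarrow> real \<Rightarrow> (complex ^ 'n option ^ 'n option) set set"
  where "hits p g a b = {C \<in> topspace (horosphere_space p). \<exists>s\<in>{a..b}. crosses p g s C}"

text \<open>
  The preimage in \<open>G\<close> is the projection of a closed set along the compact parameter interval.
\<close>

lemma closedin_hits: "closedin (horosphere_space p) (hits p g a b)"
  unfolding hits_def
proof (rule closedin_horosphere_spaceI)
  let ?T = "{(s, c). cmod (herm (g *v geo p s) (c *v null_vec p)) = 1}"
  have "closed ?T"
    using closed_Collect_eq[OF continuous_on_norm[OF continuous_on_herm_geo] continuous_on_const]
    by (simp add: split_def)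
  then show "closed {c. \<exists>s. s \<in> {a..b} \<and> (s, c) \<in> ?T}"
    by (intro closed_compact_projection) auto
  show "(\<exists>s\<in>{a..b}. crosses p g s (horo_coset p c)) \<longleftrightarrow> c \<in> {c. \<exists>s. s \<in> {a..b} \<and> (s, c) \<in> ?T}"
    if "c \<in> carrier U1n" for c
    using crosses_horo_coset[OF that] by auto
qed

text \<open>
  The unit segment starts outside the horoball and ends inside it. Unlike meeting the horosphere, this is
  an open condition.
\<close>

definition crosses_inward ::
  "'n::finite \<Rightarrow> complex ^ 'n option ^ 'n option \<Rightarrow> (complex ^ 'n option ^ 'n option) set \<Rightarrow> bool"
  where "crosses_inward p g C \<longleftrightarrow> (\<exists>c\<in>C. cmod (herm (g *v geo p 0) (c *v null_vec p)) > 1 \<and>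
    cmod (herm (g *v geo p 1) (c *v null_vec p)) < 1)"

lemma crosses_inward_horo_coset:
  assumes "c \<in> carrier U1n"
  shows "crosses_inward p g (horo_coset p c) \<longleftrightarrow>
    cmod (herm (g *v geo p 0) (c *v null_vec p)) > 1 \<and> cmod (herm (g *v geo p 1) (c *v null_vec p)) < 1"
proof
  assume "cmod (herm (g *v geo p 0) (c *v null_vec p)) > 1 \<and> cmod (herm (g *v geo p 1) (c *v null_vec p)) < 1"
  then show "crosses_inward p g (horo_coset p c)"
    using horo_coset_self[OF assms] unfolding crosses_inward_def by blast
next
  assume "crosses_inward p g (horo_coset p c)"
  then show "cmod (herm (g *v geo p 0) (c *v null_vec p)) > 1 \<and> cmod (herm (g *v geo p 1) (c *v null_vec p)) < 1"
    by (auto simp: crosses_inward_def mem_horo_coset[OF assms] herm_simps norm_mult simp del: geo_0)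
qed

lemma crosses_inward_translate:
  assumes "g \<in> carrier U1n" "c \<in> carrier U1n"
  shows "crosses_inward p (g ** h) (horo_coset p (g ** c)) \<longleftrightarrow> crosses_inward p h (horo_coset p c)"
  using assms
  by (simp add: crosses_inward_horo_coset matrix_mult_in_U1n herm_U1n del: geo_0
      flip: matrix_vector_mul_assoc)

lemma openin_crosses_inward:
  "openin (horosphere_space p) {C \<in> topspace (horosphere_space p). crosses_inward p g C}"
proof (rule openin_horosphere_spaceI)
  let ?f = "\<lambda>s c. cmod (herm (g *v geo p s) (c *v null_vec p))"
  have "open {c. 1 < ?f 0 c}" "open {c. ?f 1 c < 1}"
    by (intro open_Collect_less continuous_on_norm continuous_on_herm_mult continuous_on_const)+
  then show "open ({c. 1 < ?f 0 c} \<inter> {c. ?f 1 c < 1})"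
    by blast
qed (auto simp: crosses_inward_horo_coset simp del: geo_0)

lemma crosses_inward_imp_hits:
  assumes "C \<in> topspace (horosphere_space p)" "crosses_inward p g C"
  shows "C \<in> hits p g 0 1"
proof -
  obtain c where c: "c \<in> carrier U1n" "C = horo_coset p c"
    using horosphere_space_cases[OF assms(1)] by blast
  let ?f = "\<lambda>s. cmod (herm (g *v geo p s) (c *v null_vec p))"
  have "continuous_on UNIV ?f"
    using continuous_on_compose2[OF continuous_on_herm_geo, of UNIV "\<lambda>s. (s, c)" g p "null_vec p"]
    by (intro continuous_on_norm) (simp add: continuous_on_Pair)
  then have "continuous_on {0..1} ?f"
    using continuous_on_subset by blast
  then have "\<exists>s\<ge>0. s \<le> 1 \<and> ?f s = 1"
    using assms(2) by (intro IVT2') (auto simp: c crosses_inward_horo_coset simp del: geo_0)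
  then show ?thesis
    using assms(1) c by (auto simp: hits_def crosses_horo_coset)
qed

text \<open>
  A witness: the moduli at the endpoints are \<open>exp (1/2)\<close> and \<open>exp (-1/2)\<close>.
\<close>

lemma crosses_inward_boost: "crosses_inward p (mat 1) (horo_coset p (boost p (1 / 2)))"
proof -
  have "cmod (herm (geo p s) (boost p (1 / 2) *v null_vec p)) = exp (1 / 2 - s)" for s
  proof -
    have "herm (geo p s) (null_vec p) = - of_real (exp (- s))"
      by (simp add: herm_null_vec flip: cosh_minus_sinh)
    then show ?thesis
      by (simp add: boost_null_vec herm_simps norm_mult flip: exp_add)
  qed
  from this[of 0] this[of 1] show ?thesis
    by (simp add: crosses_inward_horo_coset)
qed

lemma translate_Collect:
  assumes g: "g \<in> carrier U1n"
    and R: "\<And>c. c \<in> carrier U1n \<Longrightarrow> R' (horo_coset p (g ** c)) \<longleftrightarrow> R (horo_coset p c)"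
  shows "(\<lambda>C. g <#\<^bsub>U1n\<^esub> C) ` {C \<in> topspace (horosphere_space p). R C}
    = {C \<in> topspace (horosphere_space p). R' C}"
proof (intro equalityI subsetI)
  fix C assume "C \<in> (\<lambda>C. g <#\<^bsub>U1n\<^esub> C) ` {C \<in> topspace (horosphere_space p). R C}"
  then show "C \<in> {C \<in> topspace (horosphere_space p). R' C}"
    using R g by (auto simp: topspace_horosphere_space_image translate_horo_coset matrix_mult_in_U1n)
next
  fix C assume C: "C \<in> {C \<in> topspace (horosphere_space p). R' C}"
  then obtain c where c: "c \<in> carrier U1n" "C = horo_coset p c"
    by (auto elim: horosphere_space_cases)
  let ?c = "matrix_inv g ** c"
  have c': "?c \<in> carrier U1n" "g ** ?c = c"
    using c matrix_inv_U1n[OF g] by (simp_all add: matrix_mult_in_U1n matrix_mul_assoc)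
  then have "R (horo_coset p ?c)"
    using R[of ?c] C c by simp
  then show "C \<in> (\<lambda>C. g <#\<^bsub>U1n\<^esub> C) ` {C \<in> topspace (horosphere_space p). R C}"
    using c c' by (auto simp: topspace_horosphere_space_image translate_horo_coset intro!: image_eqI[of _ _ "horo_coset p ?c"])
qed

section \<open>Compactness\<close>

text \<open>
  The form differs from the standard hermitian product by a multiple of the first components only, so
  elements of the group that fix \<open>e\<^sub>0\<close> are isometries for the euclidean norm.
\<close>

lemma norm_square_herm: "(norm z)\<^sup>2 = Re (herm z z) + 2 * (cmod (z $ None))\<^sup>2"
  by (simp add: norm_vec_def L2_set_def sum_nonneg herm_self UNIV_option_conv sum.reindex o_def
      del: of_real_sum of_real_power)

lemma norm_stabilizer:
  assumes "k \<in> carrier U1n" "k *v axis None 1 = axis None 1"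
  shows "norm (k *v z) = norm z"
proof -
  have "(k *v z) $ None = z $ None"
    using herm_U1n[OF assms(1), of "axis None 1" z] by (simp add: assms(2))
  then have "(norm (k *v z))\<^sup>2 = (norm z)\<^sup>2"
    by (simp add: norm_square_herm herm_U1n[OF assms(1)])
  then show ?thesis
    by simp
qed

text \<open>
  A boost changes a basis vector in two components, in each by two terms of modulus at most \<open>cosh d\<close>.
\<close>

lemma norm_boost_axis_le:
  assumes "\<bar>t\<bar> \<le> d"
  shows "norm (boost p t *v axis j 1) \<le> 1 + 4 * cosh d"
proof -
  define \<alpha> \<beta> where "\<alpha> = complex_of_real (cosh t - 1) * axis j 1 $ None + of_real (sinh t) * axis j 1 $ Some p"
    and "\<beta> = complex_of_real (sinh t) * axis j 1 $ None + of_real (cosh t - 1) * axis j 1 $ Some p"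
  have "cosh t \<le> cosh d"
    using assms cosh_real_nonneg_le_iff[of "\<bar>t\<bar>" d] by simp
  moreover have "\<bar>sinh t\<bar> \<le> cosh t"
    using sinh_le_cosh_real[of "\<bar>t\<bar>"] by (simp add: abs_if split: if_splits)
  ultimately have c: "cmod (of_real (cosh t - 1)) \<le> cosh d" and s: "cmod (of_real (sinh t)) \<le> cosh d"
    using cosh_real_ge_1[of t] unfolding norm_of_real by linarith+
  have a: "cmod (axis j 1 $ i) \<le> 1" for i :: "'a option"
    by (simp add: axis_def)
  have prod: "cmod (x * axis j 1 $ i) \<le> cosh d" if "cmod x \<le> cosh d" for x and i :: "'a option"
    using mult_mono[OF that a, of i] by (simp add: norm_mult)
  have "cmod \<alpha> \<le> 2 * cosh d" "cmod \<beta> \<le> 2 * cosh d"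
    unfolding \<alpha>_def \<beta>_def
    using norm_triangle_le[OF add_mono[OF prod[OF c, of None] prod[OF s, of "Some p"]]]
      norm_triangle_le[OF add_mono[OF prod[OF s, of None] prod[OF c, of "Some p"]]]
    by linarith+
  moreover have norm_axis: "norm (x *s axis i (1::complex)) = cmod x" for x and i :: "'a option"
    by (simp add: norm_vec_def L2_set_def axis_def norm_mult if_distrib[of norm] if_distrib[of "\<lambda>x. x\<^sup>2"]
        if_distrib[of "\<lambda>y. _ * y"] cong: if_cong)
  ultimately have "norm (axis j (1::complex)) + norm (\<alpha> *s axis None 1 :: complex ^ 'a option)
      + norm (\<beta> *s axis (Some p) 1 :: complex ^ 'a option) \<le> 1 + 4 * cosh d"
    using norm_axis[of 1 j] by simp
  moreover have "norm (boost p t *v axis j 1) \<le> norm (axis j (1::complex))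
      + norm (\<alpha> *s axis None 1 :: complex ^ 'a option) + norm (\<beta> *s axis (Some p) 1 :: complex ^ 'a option)"
    unfolding boost_mult \<alpha>_def[symmetric] \<beta>_def[symmetric]
    by (meson add_mono norm_triangle_ineq norm_triangle_le order_refl)
  ultimately show ?thesis
    by linarith
qed

lemma compact_bounded_U1n:
  "compact {g \<in> carrier U1n. \<forall>j. norm (g *v axis j 1 :: complex ^ 'n::finite option) \<le> R}"
    (is "compact ?Q")
proof -
  have "closed {g :: complex ^ 'n option ^ 'n option. herm (g *v z) (g *v w) = herm z w}" for z w
    by (intro closed_Collect_eq continuous_on_herm_mult continuous_on_const)
  then have "closed (carrier (U1n :: (complex ^ 'n option ^ 'n option) monoid))"
    unfolding U1n_def by (simp add: closed_Collect_all)
  moreover have "continuous_on UNIV (\<lambda>g :: complex ^ 'n option ^ 'n option. norm (g *v axis j 1))" for j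
    unfolding matrix_vector_mult_def by (intro continuous_intros)
  then have "closed {g :: complex ^ 'n option ^ 'n option. norm (g *v axis j 1) \<le> R}" for j
    by (intro closed_Collect_le continuous_on_const)
  then have "closed {g :: complex ^ 'n option ^ 'n option. \<forall>j. norm (g *v axis j 1) \<le> R}"
    by (rule closed_Collect_all)
  ultimately have "closed ?Q"
    by (simp add: Collect_conj_eq closed_Int)
  moreover have "bounded ?Q"
    unfolding bounded_iff
  proof (intro exI ballI)
    fix g assume g: "g \<in> ?Q"
    have entry: "norm (g $ i $ j) \<le> R" for i j
    proof -
      have "norm (g $ i $ j) \<le> norm (g *v axis j 1)"
        using Finite_Cartesian_Product.norm_nth_le[of "g *v axis j 1" i] by (simp add: matrix_vector_mult_axis)
      also have "\<dots> \<le> R"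
        using g by blast
      finally show ?thesis .
    qed
    have norm_le: "norm x \<le> (\<Sum>i\<in>UNIV. norm (x $ i))" for x :: "'b::real_normed_vector ^ 'n option"
      unfolding norm_vec_def by (intro L2_set_le_sum) auto
    have "norm g \<le> (\<Sum>i\<in>UNIV. norm (g $ i))"
      by (rule norm_le)
    also have "\<dots> \<le> (\<Sum>i\<in>(UNIV :: 'n option set). \<Sum>j\<in>(UNIV :: 'n option set). R)"
      by (intro sum_mono order_trans[OF norm_le] entry)
    finally show "norm g \<le> (\<Sum>i\<in>(UNIV :: 'n option set). \<Sum>j\<in>(UNIV :: 'n option set). R)" .
  qed
  ultimately show ?thesis
    by (simp add: compact_eq_bounded_closed)
qed

text \<open>
  The part of the Iwasawa decomposition that matters for compactness. Let \<open>r\<close> be the modulus of the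
  component of the null vector \<open>v = c v\<^sub>0\<close> along \<open>e\<^sub>0\<close>. The component along \<open>e\<^sub>p\<close> has modulus at
  most \<open>r\<close>, so a horosphere crossed at time \<open>s\<close> has \<open>exp (-s) \<le> r \<le> exp s\<close>. After a change of
  phase, \<open>v\<close> is the image of \<open>r v\<^sub>0\<close> under an element fixing \<open>e\<^sub>0\<close>, and \<open>r v\<^sub>0\<close> is the
  image of \<open>v\<^sub>0\<close> under the boost with parameter \<open>ln r\<close> in \<open>[-d, d]\<close>.
\<close>

lemma null_vector_representative:
  assumes c: "c \<in> carrier U1n" and s: "0 \<le> s" "s \<le> d"
    and 1: "cmod (herm (geo p s) (c *v null_vec p)) = 1"
  obtains q where "q \<in> carrier U1n" "horo_coset p q = horo_coset p c"
    "\<And>j. norm (q *v axis j 1) \<le> 1 + 4 * cosh d"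
proof -
  define v where "v = c *v null_vec p"
  define r where "r = cmod (v $ None)"
  have null: "herm v v = 0"
    by (simp add: v_def herm_U1n[OF c] herm_null_vec)
  have vp: "cmod (v $ Some p) \<le> r"
  proof -
    have "of_real ((\<Sum>i\<in>UNIV. (cmod (v $ Some i))\<^sup>2) - (cmod (v $ None))\<^sup>2) = complex_of_real 0"
      using null unfolding herm_self by simp
    then have "(\<Sum>i\<in>UNIV. (cmod (v $ Some i))\<^sup>2) = r\<^sup>2"
      unfolding of_real_eq_iff r_def by simp
    then have "(cmod (v $ Some p))\<^sup>2 \<le> r\<^sup>2"
      by (metis (no_types, lifting) UNIV_I finite member_le_sum zero_le_power2)
    then show ?thesis
      by (simp add: r_def)
  qed
  have "herm (geo p s) v = of_real (sinh s) * v $ Some p - of_real (cosh s) * v $ None"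
    by (simp add: geo_def herm_simps)
  then have v1: "cmod (of_real (sinh s) * v $ Some p - of_real (cosh s) * v $ None) = 1"
    using 1 by (simp add: v_def)
  have sp: "cmod (of_real (sinh s) * v $ Some p) \<le> sinh s * r"
    using s vp by (simp add: norm_mult mult_left_mono)
  have cn: "cmod (of_real (cosh s) * v $ None) = cosh s * r"
    by (simp add: norm_mult r_def)
  have lower: "1 \<le> exp s * r"
    using norm_triangle_ineq4[of "of_real (sinh s) * v $ Some p" "of_real (cosh s) * v $ None"] sp cn v1
    by (simp add: algebra_simps flip: cosh_plus_sinh)
  have upper: "exp (- s) * r \<le> 1"
    using norm_triangle_ineq3[of "of_real (sinh s) * v $ Some p" "of_real (cosh s) * v $ None"] sp cn v1
    by (simp add: algebra_simps flip: cosh_minus_sinh)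
  have r: "r > 0"
    using lower by (metis exp_ge_zero linorder_not_le mult_nonneg_nonpos zero_less_one order_less_le_trans)
  define t where "t = ln r"
  have t: "exp t = r"
    using r by (simp add: t_def)
  have "0 \<le> s + t" "t - s \<le> 0"
    using lower upper unfolding t[symmetric] exp_add[symmetric]
    by (simp_all add: add.commute)
  then have td: "\<bar>t\<bar> \<le> d"
    using s by linarith
  define u where "u = cnj (v $ None) / of_real r"
  have u: "cmod u = 1"
    using r by (simp add: u_def norm_divide r_def)
  have uv: "(u *s v) $ None = of_real r"
    using r complex_norm_square[of "v $ None", symmetric]
    by (simp add: u_def r_def[symmetric] power2_eq_square mult.commute[of "cnj _"] field_simps)
  have "herm (of_real r *s null_vec p) (of_real r *s null_vec p) = herm (u *s v) (u *s v)"
    unfolding herm_simps null by (simp add: herm_null_vec)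
  moreover have "(of_real r *s null_vec p) $ None = (u *s v) $ None"
    unfolding uv by simp
  ultimately obtain k where k: "k \<in> carrier U1n" "k *v (of_real r *s null_vec p) = u *s v"
      "k *v axis None 1 = axis None 1"
    using ex_stabilizer_mapsto by metis
  show ?thesis
  proof
    show q: "k ** boost p t \<in> carrier U1n"
      using k(1) by (simp add: matrix_mult_in_U1n)
    show "horo_coset p (k ** boost p t) = horo_coset p c"
      by (rule horo_coset_eqI[OF c q u])
         (simp add: boost_null_vec t k(2)[unfolded v_def] flip: matrix_vector_mul_assoc)
    show "norm ((k ** boost p t) *v axis j 1) \<le> 1 + 4 * cosh d" for j
      using norm_boost_axis_le[OF td, of p j]
      by (simp add: norm_stabilizer[OF k(1,3)] flip: matrix_vector_mul_assoc)
  qed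
qed

lemma hits_subset_compactin:
  obtains K where "compactin (horosphere_space p) K" "hits p (mat 1) 0 d \<subseteq> K"
proof
  let ?Q = "{g \<in> carrier U1n. \<forall>j. norm (g *v axis j 1 :: complex ^ 'a option) \<le> 1 + 4 * cosh d}"
  have "compactin (top_of_set (carrier U1n)) ?Q"
    using compact_bounded_U1n by (auto simp: compactin_subtopology)
  then show "compactin (horosphere_space p) (horo_coset p ` ?Q)"
    by (rule image_compactin[OF _ continuous_map_horo_coset])
  show "hits p (mat 1) 0 d \<subseteq> horo_coset p ` ?Q"
  proof
    fix C assume "C \<in> hits p (mat 1) 0 d"
    then obtain c s where c: "c \<in> carrier U1n" "C = horo_coset p c"
      and s: "0 \<le> s" "s \<le> d" "cmod (herm (geo p s) (c *v null_vec p)) = 1"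
      by (auto simp: hits_def crosses_horo_coset elim!: horosphere_space_cases)
    obtain q where "q \<in> carrier U1n" "horo_coset p q = horo_coset p c"
      "\<And>j. norm (q *v axis j 1) \<le> 1 + 4 * cosh d"
      using null_vector_representative[OF c(1) s] by blast
    then show "C \<in> horo_coset p ` ?Q"
      unfolding c(2) by (intro image_eqI[of _ _ q]) auto
  qed
qed

section \<open>Nonnegative additive functions\<close>

text \<open>
  Nonnegativity makes \<open>f\<close> monotone. Squeezing \<open>f (n x) = n f x\<close> between the values at the neighbouring
  integers gives \<open>n |f x - f 1 x| \<le> f 1\<close> for all \<open>n\<close>.
\<close>

lemma nonneg_additive_imp_linear:
  fixes f :: "real \<Rightarrow> real"
  assumes nonneg: "\<And>x. 0 \<le> x \<Longrightarrow> 0 \<le> f x"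
    and add: "\<And>x y. 0 \<le> x \<Longrightarrow> 0 \<le> y \<Longrightarrow> f (x + y) = f x + f y"
    and x: "0 \<le> x"
  shows "f x = f 1 * x"
proof -
  have mono: "f a \<le> f b" if "0 \<le> a" "a \<le> b" for a b
    using add[of a "b - a"] nonneg[of "b - a"] that by simp
  have mult: "f (real n * a) = real n * f a" if "0 \<le> a" for n a
  proof (induction n)
    case 0
    show ?case
      using add[of 0 0] by simp
  next
    case (Suc n)
    then show ?case
      using add[of a "real n * a"] that by (simp add: algebra_simps)
  qed
  have bound: "real n * \<bar>f x - f 1 * x\<bar> \<le> f 1" for n
  proof -
    define m where "m = nat \<lfloor>real n * x\<rfloor>"
    have m: "real m \<le> real n * x" "real n * x \<le> real (Suc m)"
      using x by (simp_all add: m_def) linarith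
    have "f (real m * 1) \<le> f (real n * x)" "f (real n * x) \<le> f (real (Suc m) * 1)"
      using m x by (auto intro!: mono)
    then have "real m * f 1 \<le> real n * f x" "real n * f x \<le> real (Suc m) * f 1"
      by (simp_all only: mult[OF zero_le_one] mult[OF x])
    moreover have "real m * f 1 \<le> real n * x * f 1" "real n * x * f 1 \<le> real (Suc m) * f 1"
      using m nonneg[of 1] by (auto intro!: mult_right_mono)
    moreover have "real (Suc m) * f 1 = real m * f 1 + f 1"
      by (simp add: algebra_simps)
    ultimately have "\<bar>real n * f x - real n * x * f 1\<bar> \<le> f 1"
      by linarith
    moreover have "real n * \<bar>f x - f 1 * x\<bar> = \<bar>real n * f x - real n * x * f 1\<bar>"
      using abs_mult[of "real n" "f x - f 1 * x"] by (simp add: algebra_simps)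
    ultimately show ?thesis
      by simp
  qed
  show ?thesis
  proof (rule ccontr)
    assume "f x \<noteq> f 1 * x"
    then obtain n where "f 1 < real n * \<bar>f x - f 1 * x\<bar>"
      using reals_Archimedean3[of "\<bar>f x - f 1 * x\<bar>"] by auto
    then show False
      using bound[of n] by linarith
  qed
qed

section \<open>Counting crossings with an invariant measure\<close>

text \<open>
  As a horosphere crosses a segment at most twice, the crossing number is the sum of the indicators of
  \<open>hits\<close> and of this set. Its measurability and the invariance of its integral thus reduce to statements
  about two sets.
\<close>

definition double_hits ::
  "'n::finite \<Rightarrow> complex ^ 'n option ^ 'n option \<Rightarrow> real \<Rightarrow> (complex ^ 'n option ^ 'n option) set set"
  where "double_hits p g d =
    {C \<in> topspace (horosphere_space p). \<exists>s\<in>{0..d}. \<exists>t\<in>{0..d}. s < t \<and> crosses p g s C \<and> crosses p g t C}"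

text \<open>
  Two different crossing times can be separated by two disjoint intervals with rational inner endpoints,
  so this set is a countable union of closed sets.
\<close>

lemma double_hits_eq_UN:
  "double_hits p g d = (\<Union>(q, q')\<in>{(q, q') \<in> \<rat> \<times> \<rat>. 0 \<le> q \<and> q < q' \<and> q' \<le> d}.
     hits p g 0 q \<inter> hits p g q' d)"
proof (intro equalityI subsetI)
  fix C assume "C \<in> double_hits p g d"
  then obtain s t where C: "C \<in> topspace (horosphere_space p)" "crosses p g s C" "crosses p g t C"
    and st: "0 \<le> s" "s < t" "t \<le> d"
    by (auto simp: double_hits_def)
  obtain q where q: "q \<in> \<rat>" "s < q" "q < t"
    using Rats_dense_in_real[OF st(2)] by blast
  obtain q' where q': "q' \<in> \<rat>" "q < q'" "q' < t"
    using Rats_dense_in_real[OF q(3)] by blast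
  have "C \<in> hits p g 0 q \<inter> hits p g q' d"
    using C st q q' by (auto simp: hits_def)
  moreover have "(q, q') \<in> {(q, q') \<in> \<rat> \<times> \<rat>. 0 \<le> q \<and> q < q' \<and> q' \<le> d}"
    using q q' st by auto
  ultimately show "C \<in> (\<Union>(q, q')\<in>{(q, q') \<in> \<rat> \<times> \<rat>. 0 \<le> q \<and> q < q' \<and> q' \<le> d}.
     hits p g 0 q \<inter> hits p g q' d)"
    by blast
next
  fix C assume "C \<in> (\<Union>(q, q')\<in>{(q, q') \<in> \<rat> \<times> \<rat>. 0 \<le> q \<and> q < q' \<and> q' \<le> d}.
     hits p g 0 q \<inter> hits p g q' d)"
  then obtain q q' where q: "0 \<le> q" "q < q'" "q' \<le> d" and C: "C \<in> hits p g 0 q" "C \<in> hits p g q' d"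
    by auto
  obtain s t where "s \<in> {0..q}" "crosses p g s C" "t \<in> {q'..d}" "crosses p g t C"
    using C unfolding hits_def by blast
  then have "s \<in> {0..d}" "t \<in> {0..d}" "s < t"
    using q by auto
  then show "C \<in> double_hits p g d"
    using C \<open>crosses p g s C\<close> \<open>crosses p g t C\<close> unfolding double_hits_def hits_def by blast
qed

lemma card_crossing_times_eq:
  assumes "C \<in> topspace (horosphere_space p)"
  shows "(of_nat (card (crossing_times p g d C)) :: ennreal)
    = indicator (hits p g 0 d) C + indicator (double_hits p g d) C"
proof -
  let ?T = "crossing_times p g d C"
  obtain c where c: "c \<in> carrier U1n" "C = horo_coset p c"
    using horosphere_space_cases[OF assms] by blast
  have fin: "finite ?T" and le: "card ?T \<le> 2"
    using crossing_times_bound[OF c(1)] by (simp_all add: c(2))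
  have hits: "C \<in> hits p g 0 d \<longleftrightarrow> 1 \<le> card ?T"
    using assms card_gt_0_iff[of ?T] fin by (auto simp: hits_def crossing_times_def Suc_le_eq)
  have "C \<in> double_hits p g d \<longleftrightarrow> (\<exists>s\<in>?T. \<exists>t\<in>?T. s < t)"
    using assms unfolding double_hits_def crossing_times_def by blast
  also have "\<dots> \<longleftrightarrow> (\<exists>s\<in>?T. \<exists>t\<in>?T. s \<noteq> t)"
    by (metis less_irrefl linorder_neqE_linordered_idom)
  also have "\<dots> \<longleftrightarrow> 2 \<le> card ?T"
  proof
    assume "\<exists>s\<in>?T. \<exists>t\<in>?T. s \<noteq> t"
    then obtain s t where "{s, t} \<subseteq> ?T" "s \<noteq> t"
      by auto
    then show "2 \<le> card ?T"
      using card_mono[OF fin, of "{s, t}"] by simp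
  next
    assume "2 \<le> card ?T"
    then have "\<not> is_singleton ?T" "?T \<noteq> {}"
      by (auto simp: is_singleton_altdef)
    then show "\<exists>s\<in>?T. \<exists>t\<in>?T. s \<noteq> t"
      by (metis is_singletonI' )
  qed
  finally have double: "C \<in> double_hits p g d \<longleftrightarrow> 2 \<le> card ?T" .
  consider "card ?T = 0" | "card ?T = 1" | "card ?T = 2"
    using le by linarith
  then show ?thesis
    by cases (simp_all add: indicator_def hits double)
qed

lemma crossing_times_add:
  assumes "0 \<le> s" "0 \<le> t"
  shows "crossing_times p (mat 1) (s + t) C
    = crossing_times p (mat 1) s C \<union> (+) s ` crossing_times p (boost p s) t C"
proof -
  have *: "crosses p (boost p s) x C \<longleftrightarrow> crosses p (mat 1) (s + x) C" for x
    using crosses_boost[of p "mat 1" s x C] by simp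
  show ?thesis
  proof (intro equalityI subsetI)
    fix x assume x: "x \<in> crossing_times p (mat 1) (s + t) C"
    show "x \<in> crossing_times p (mat 1) s C \<union> (+) s ` crossing_times p (boost p s) t C"
    proof (cases "x \<le> s")
      case False
      then have "x - s \<in> crossing_times p (boost p s) t C"
        using x by (simp add: crossing_times_def *)
      then show ?thesis
        by (intro UnI2 image_eqI[of _ _ "x - s"]) auto
    qed (use x in \<open>simp add: crossing_times_def\<close>)
  qed (use assms in \<open>auto simp: crossing_times_def *\<close>)
qed

locale invariant_horosphere_measure =
  fixes p :: "'n::finite" and \<mu> :: "(complex ^ 'n option ^ 'n option) set measure"
  assumes radon: "radon_measure (horosphere_space p) \<mu>"
    and invariant: "G_invariant \<mu>"
    and nonzero: "emeasure \<mu> (space \<mu>) \<noteq> 0"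
begin

lemma space_eq: "space \<mu> = topspace (horosphere_space p)"
  using radon by (simp add: radon_measure_def)

lemma openin_sets: "openin (horosphere_space p) U \<Longrightarrow> U \<in> sets \<mu>"
  using radon by (auto simp: radon_measure_def)

lemma closedin_sets:
  assumes "closedin (horosphere_space p) F"
  shows "F \<in> sets \<mu>"
proof -
  have "space \<mu> - F \<in> sets \<mu>"
    using assms by (auto simp: space_eq closedin_def intro: openin_sets)
  moreover have "F = space \<mu> - (space \<mu> - F)"
    using closedin_subset[OF assms] by (auto simp: space_eq)
  ultimately show ?thesis
    by (metis sets.compl_sets)
qed

lemma hits_sets [measurable]: "hits p g a b \<in> sets \<mu>"
  by (rule closedin_sets[OF closedin_hits])

lemma double_hits_sets [measurable]: "double_hits p g d \<in> sets \<mu>"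
proof -
  have "countable (\<rat> \<times> \<rat> :: (real \<times> real) set)"
    by (simp add: countable_rat)
  then have "countable {(q, q') \<in> \<rat> \<times> \<rat> :: (real \<times> real) set. 0 \<le> q \<and> q < q' \<and> q' \<le> d}"
    by (rule countable_subset[rotated]) auto
  then show ?thesis
    unfolding double_hits_eq_UN by (intro sets.countable_UN') auto
qed

lemma emeasure_translate:
  assumes "g \<in> carrier U1n" "{C \<in> topspace (horosphere_space p). R C} \<in> sets \<mu>"
    and "\<And>c. c \<in> carrier U1n \<Longrightarrow> R' (horo_coset p (g ** c)) \<longleftrightarrow> R (horo_coset p c)"
  shows "emeasure \<mu> {C \<in> topspace (horosphere_space p). R' C}
    = emeasure \<mu> {C \<in> topspace (horosphere_space p). R C}"
  using invariant assms(1,2) translate_Collect[of g R' p R, OF assms(1,3)]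
  unfolding G_invariant_def by (metis (no_types, lifting))

lemma emeasure_hits_translate:
  assumes "g \<in> carrier U1n"
  shows "emeasure \<mu> (hits p g a b) = emeasure \<mu> (hits p (mat 1) a b)"
  unfolding hits_def
  using hits_sets[of "mat 1" a b] crosses_translate[OF assms, of _ p "mat 1"]
  by (intro emeasure_translate[OF assms]) (simp_all add: hits_def)

lemma emeasure_double_hits_translate:
  assumes "g \<in> carrier U1n"
  shows "emeasure \<mu> (double_hits p g d) = emeasure \<mu> (double_hits p (mat 1) d)"
  unfolding double_hits_def
  using double_hits_sets[of "mat 1" d] crosses_translate[OF assms, of _ p "mat 1"]
  by (intro emeasure_translate[OF assms]) (simp_all add: double_hits_def)

lemma emeasure_compactin_finite:
  assumes K: "compactin (horosphere_space p) K" and A: "A \<subseteq> K"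
  shows "emeasure \<mu> A < \<infinity>"
proof -
  let ?\<U> = "{U. openin (horosphere_space p) U \<and> emeasure \<mu> U < \<infinity>}"
  have "\<forall>x\<in>topspace (horosphere_space p). \<exists>U. openin (horosphere_space p) U \<and> x \<in> U \<and> emeasure \<mu> U < \<infinity>"
    using radon unfolding radon_measure_def by blast
  then have "K \<subseteq> \<Union>?\<U>"
    using compactin_subset_topspace[OF K] by blast
  then obtain \<F> where \<F>: "finite \<F>" "\<F> \<subseteq> ?\<U>" "K \<subseteq> \<Union>\<F>"
    using compactinD[OF K, of ?\<U>] by blast
  have "emeasure \<mu> A \<le> emeasure \<mu> (\<Union>\<F>)"
    using \<F> A by (intro emeasure_mono sets.finite_Union) (auto intro: openin_sets)
  also have "\<dots> = emeasure \<mu> (\<Union>U\<in>\<F>. U)"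
    by simp
  also have "\<dots> \<le> (\<Sum>U\<in>\<F>. emeasure \<mu> U)"
    using \<F> by (intro emeasure_subadditive_finite) (auto intro: openin_sets)
  also have "\<dots> < \<infinity>"
    using \<F> by (auto simp: less_top[symmetric])
  finally show ?thesis .
qed

lemma emeasure_hits_finite: "emeasure \<mu> (hits p (mat 1) 0 d) < \<infinity>"
  using hits_subset_compactin emeasure_compactin_finite by metis

text \<open>
  The integral of the crossing number over a segment of length \<open>d\<close>, in the form given by
  \<open>card_crossing_times_eq\<close>.
\<close>

definition crossing_measure :: "real \<Rightarrow> ennreal" where
  "crossing_measure d = emeasure \<mu> (hits p (mat 1) 0 d) + emeasure \<mu> (double_hits p (mat 1) d)"

lemma card_crossing_times_measurable:
  "(\<lambda>C. of_nat (card (crossing_times p g d C)) :: ennreal) \<in> borel_measurable \<mu>"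
proof -
  have "(\<lambda>C. indicator (hits p g 0 d) C + indicator (double_hits p g d) C :: ennreal) \<in> borel_measurable \<mu>"
    by measurable
  then show ?thesis
    by (subst measurable_cong[OF card_crossing_times_eq]) (auto simp: space_eq)
qed

lemma nn_integral_card_crossing_times:
  assumes "g \<in> carrier U1n"
  shows "(\<integral>\<^sup>+C. of_nat (card (crossing_times p g d C)) \<partial>\<mu>) = crossing_measure d"
proof -
  have "(\<integral>\<^sup>+C. of_nat (card (crossing_times p g d C)) \<partial>\<mu>)
      = (\<integral>\<^sup>+C. indicator (hits p g 0 d) C + indicator (double_hits p g d) C \<partial>\<mu>)"
    by (intro nn_integral_cong card_crossing_times_eq) (simp add: space_eq)
  also have "\<dots> = emeasure \<mu> (hits p g 0 d) + emeasure \<mu> (double_hits p g d)"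
    by (simp add: nn_integral_add)
  finally show ?thesis
    by (simp add: crossing_measure_def emeasure_hits_translate[OF assms]
        emeasure_double_hits_translate[OF assms])
qed

lemma crossing_measure_finite: "crossing_measure d < \<infinity>"
proof -
  have sub: "double_hits p (mat 1) d \<subseteq> hits p (mat 1) 0 d"
    by (auto simp: double_hits_def hits_def)
  have "emeasure \<mu> (double_hits p (mat 1) d) < \<infinity>"
    by (rule le_less_trans[OF emeasure_mono[OF sub hits_sets] emeasure_hits_finite])
  then show ?thesis
    using emeasure_hits_finite by (simp add: crossing_measure_def)
qed

lemma emeasure_hits_point: "emeasure \<mu> (hits p (mat 1) s s) = emeasure \<mu> (hits p (mat 1) 0 0)"
proof -
  have "hits p (mat 1) s s = hits p (boost p s) 0 0"
    using crosses_boost[of p "mat 1" s 0] by (simp add: hits_def)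
  then show ?thesis
    using emeasure_hits_translate[OF boost_U1n[of p s], of 0 0] by simp
qed

text \<open>
  The points at the times \<open>i / n\<close> for \<open>i < n\<close> all lie on one unit segment; a horosphere through \<open>j\<close> of
  them crosses the segment at least \<open>j\<close> times.
\<close>

lemma emeasure_hits_point_eq_0: "emeasure \<mu> (hits p (mat 1) s s) = 0"
proof -
  let ?m = "emeasure \<mu> (hits p (mat 1) 0 0)"
  have bound: "of_nat n * ?m \<le> crossing_measure 1" for n
  proof -
    let ?x = "\<lambda>i. real i / real n"
    have "of_nat n * ?m = (\<Sum>i<n. emeasure \<mu> (hits p (mat 1) (?x i) (?x i)))"
      unfolding emeasure_hits_point[of "?x _"] by simp
    also have "\<dots> = (\<integral>\<^sup>+C. (\<Sum>i<n. indicator (hits p (mat 1) (?x i) (?x i)) C) \<partial>\<mu>)"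
      by (subst nn_integral_sum) auto
    also have "\<dots> \<le> (\<integral>\<^sup>+C. of_nat (card (crossing_times p (mat 1) 1 C)) \<partial>\<mu>)"
    proof (rule nn_integral_mono)
      fix C assume "C \<in> space \<mu>"
      then obtain c where c: "c \<in> carrier U1n" "C = horo_coset p c"
        using horosphere_space_cases by (metis space_eq)
      let ?I = "{i \<in> {..<n}. C \<in> hits p (mat 1) (?x i) (?x i)}"
      have "card ?I \<le> card (crossing_times p (mat 1) 1 C)"
      proof (rule card_inj_on_le)
        show "inj_on ?x ?I"
          by (auto intro!: inj_onI)
        show "?x ` ?I \<subseteq> crossing_times p (mat 1) 1 C"
          by (auto simp: crossing_times_def hits_def)
        show "finite (crossing_times p (mat 1) 1 C)"
          using crossing_times_bound(1)[OF c(1)] by (simp add: c(2))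
      qed
      moreover have "(\<Sum>i<n. indicator (hits p (mat 1) (?x i) (?x i)) C :: ennreal) = of_nat (card ?I)"
        by (simp add: indicator_def sum.If_cases Int_def)
      ultimately show "(\<Sum>i<n. indicator (hits p (mat 1) (?x i) (?x i)) C :: ennreal)
          \<le> of_nat (card (crossing_times p (mat 1) 1 C))"
        by (simp only: of_nat_mono)
    qed
    also have "\<dots> = crossing_measure 1"
      by (simp add: nn_integral_card_crossing_times)
    finally show ?thesis .
  qed
  obtain m where m: "?m = ennreal m" "0 \<le> m"
    using emeasure_hits_finite[of 0] by (cases ?m) auto
  obtain b where b: "crossing_measure 1 = ennreal b" "0 \<le> b"
    using crossing_measure_finite[of 1] by (cases "crossing_measure 1") auto
  have "real n * m \<le> b" for n
    using bound[of n] m b by (simp add: ennreal_of_nat_eq_real_of_nat flip: ennreal_mult)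
  then have "m \<le> 0"
    by (meson linorder_not_le reals_Archimedean3)
  then have "?m = 0"
    using m by simp
  then show ?thesis
    unfolding emeasure_hits_point[of s] .
qed

text \<open>
  Away from the null set of horospheres through the common endpoint, the two segments are crossed at
  different times. The second segment is a translate of the standard one.
\<close>

lemma crossing_measure_add:
  assumes "0 \<le> s" "0 \<le> t"
  shows "crossing_measure (s + t) = crossing_measure s + crossing_measure t"
proof -
  have AE: "AE C in \<mu>. C \<notin> hits p (mat 1) s s"
    by (intro AE_not_in null_setsI emeasure_hits_point_eq_0 hits_sets)
  have eq: "(of_nat (card (crossing_times p (mat 1) (s + t) C)) :: ennreal)
      = of_nat (card (crossing_times p (mat 1) s C)) + of_nat (card (crossing_times p (boost p s) t C))"
    if C: "C \<notin> hits p (mat 1) s s" "C \<in> space \<mu>" for C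
  proof -
    obtain c where c: "c \<in> carrier U1n" "C = horo_coset p c"
      using horosphere_space_cases C(2) by (metis space_eq)
    have "\<not> crosses p (mat 1) s C"
      using C by (auto simp: hits_def space_eq)
    then have "crossing_times p (mat 1) s C \<inter> (+) s ` crossing_times p (boost p s) t C = {}"
      using crosses_boost[of p "mat 1" s 0 C] by (auto simp: crossing_times_def)
    then have "card (crossing_times p (mat 1) (s + t) C)
        = card (crossing_times p (mat 1) s C) + card ((+) s ` crossing_times p (boost p s) t C)"
      unfolding crossing_times_add[OF assms] c(2)
      by (intro card_Un_disjoint finite_imageI crossing_times_bound(1)[OF c(1)])
    then show ?thesis
      by (simp add: card_image)
  qed
  have "crossing_measure (s + t) = (\<integral>\<^sup>+C. of_nat (card (crossing_times p (mat 1) (s + t) C)) \<partial>\<mu>)"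
    by (simp add: nn_integral_card_crossing_times)
  also have "\<dots> = (\<integral>\<^sup>+C. of_nat (card (crossing_times p (mat 1) s C))
      + of_nat (card (crossing_times p (boost p s) t C)) \<partial>\<mu>)"
    using AE by (intro nn_integral_cong_AE) (auto simp: eq elim: AE_mp)
  also have "\<dots> = crossing_measure s + crossing_measure t"
    by (subst nn_integral_add)
       (auto intro: card_crossing_times_measurable simp: nn_integral_card_crossing_times)
  finally show ?thesis .
qed

lemma crossing_measure_1_neq_0: "crossing_measure 1 \<noteq> 0"
proof
  let ?W = "\<lambda>g. {C \<in> topspace (horosphere_space p). crosses_inward p g C}"
  assume "crossing_measure 1 = 0"
  then have "emeasure \<mu> (hits p (mat 1) 0 1) = 0"
    by (simp add: crossing_measure_def)
  moreover have sub: "?W (mat 1) \<subseteq> hits p (mat 1) 0 1"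
    using crosses_inward_imp_hits by blast
  ultimately have "emeasure \<mu> (?W (mat 1)) = 0"
    using emeasure_mono[OF sub hits_sets] by simp
  then have W0: "emeasure \<mu> (?W g) = 0" if "g \<in> carrier U1n" for g
    using emeasure_translate[OF that openin_sets[OF openin_crosses_inward], of "crosses_inward p g" "mat 1"]
      crosses_inward_translate[OF that, of _ p "mat 1"] by simp
  have cover: "\<exists>g\<in>carrier U1n. C \<in> ?W g" if C: "C \<in> topspace (horosphere_space p)" for C
  proof -
    obtain c where c: "c \<in> carrier U1n" "C = horo_coset p c"
      using horosphere_space_cases[OF C] by blast
    \<comment> \<open>The translation that takes the witness horosphere to \<open>C\<close>.\<close>
    define g where "g = c ** matrix_inv (boost p (1 / 2))"
    have g: "g \<in> carrier U1n" "g ** boost p (1 / 2) = c"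
      by (simp_all add: g_def matrix_mult_in_U1n c(1) matrix_inv_U1n flip: matrix_mul_assoc)
    have "crosses_inward p g C"
      using crosses_inward_translate[OF g(1) boost_U1n, of p "mat 1" p "1 / 2"]
        crosses_inward_boost[of p] by (simp add: g(2) c(2))
    then show ?thesis
      using g(1) C by blast
  qed
  have null: "emeasure \<mu> K = 0" if K: "compactin (horosphere_space p) K" for K
  proof -
    have "K \<subseteq> \<Union>(?W ` carrier U1n)"
      using compactin_subset_topspace[OF K] cover by blast
    then obtain \<F> where \<F>: "finite \<F>" "\<F> \<subseteq> ?W ` carrier U1n" "K \<subseteq> \<Union>\<F>"
      using compactinD[OF K, of "?W ` carrier U1n"] openin_crosses_inward by blast
    have "\<Union>\<F> \<in> null_sets \<mu>"
      using \<F> W0 openin_sets[OF openin_crosses_inward]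
      by (intro null_sets.finite_Union) (auto intro!: null_setsI)
    then show ?thesis
      using \<F>(3) emeasure_mono[OF \<F>(3), of \<mu>] by (auto simp: null_setsD1)
  qed
  have "emeasure \<mu> (space \<mu>) =
      (SUP K\<in>{K. compactin (horosphere_space p) K \<and> K \<in> sets \<mu> \<and> K \<subseteq> space \<mu>}. emeasure \<mu> K)"
    using radon sets.top[of \<mu>] unfolding radon_measure_def by blast
  also have "\<dots> \<le> 0"
    by (rule SUP_least) (simp add: null)
  finally have "emeasure \<mu> (space \<mu>) \<le> 0" .
  then show False
    using nonzero by simp
qed

lemma crossing_measure_linear:
  assumes "0 \<le> d"
  shows "crossing_measure d = ennreal (enn2real (crossing_measure 1) * d)"
proof -
  let ?f = "\<lambda>d. enn2real (crossing_measure d)"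
  have "?f d = ?f 1 * d"
  proof (rule nonneg_additive_imp_linear[OF _ _ assms])
    show "?f (x + y) = ?f x + ?f y" if "0 \<le> x" "0 \<le> y" for x y
      using crossing_measure_add[OF that] crossing_measure_finite
      by (simp add: enn2real_plus)
  qed simp
  then show ?thesis
    using crossing_measure_finite[of d] by (metis ennreal_enn2real infinity_ennreal_def)
qed

lemma nn_integral_meets:
  assumes "X \<in> complex_hyperbolic" "Y \<in> complex_hyperbolic"
  shows "meets p X Y \<in> borel_measurable \<mu>"
    and "(\<integral>\<^sup>+C. meets p X Y C \<partial>\<mu>) = ennreal (enn2real (crossing_measure 1) * hdist X Y)"
proof -
  obtain g d where g: "g \<in> carrier U1n" and d: "0 \<le> d"
    and XY: "X = proj (g *v geo p 0)" "Y = proj (g *v geo p d)"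
    using two_point_homogeneous[OF assms] by blast
  have eq: "meets p X Y C = of_nat (card (crossing_times p g d C))" if C: "C \<in> space \<mu>" for C
  proof -
    obtain c where "c \<in> carrier U1n" "C = horo_coset p c"
      using horosphere_space_cases C by (metis space_eq)
    then show ?thesis
      using meets_eq_card[OF g d] by (simp add: XY)
  qed
  show "meets p X Y \<in> borel_measurable \<mu>"
    using card_crossing_times_measurable by (subst measurable_cong[OF eq]) auto
  have "hdist X Y = d"
    using hdist_geo[OF g, of p 0 d] d unfolding XY by simp
  then show "(\<integral>\<^sup>+C. meets p X Y C \<partial>\<mu>) = ennreal (enn2real (crossing_measure 1) * hdist X Y)"
    using nn_integral_cong[OF eq, of \<mu>] nn_integral_card_crossing_times[OF g, of d]
      crossing_measure_linear[OF d] by simp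
qed

end

theorem proposition4p1:
  fixes p :: "'n::finite"
    and \<mu> :: "(complex ^ 'n option ^ 'n option) set measure"
  assumes "radon_measure (horosphere_space p) \<mu>"
    and "G_invariant \<mu>"
    and "emeasure \<mu> (space \<mu>) \<noteq> 0"
  shows "\<exists>k::real. k > 0 \<and>
    (\<forall>x\<in>complex_hyperbolic. \<forall>y\<in>complex_hyperbolic.
       meets p x y \<in> borel_measurable \<mu> \<and>
       (\<integral>\<^sup>+h. meets p x y h \<partial>\<mu>) = ennreal (k * hdist x y))"
proof -
  interpret invariant_horosphere_measure p \<mu>
    using assms by unfold_locales
  have "enn2real (crossing_measure 1) > 0"
    using crossing_measure_1_neq_0 crossing_measure_finite[of 1]
    by (simp add: enn2real_positive_iff zero_less_iff_neq_zero)
  then show ?thesis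
    using nn_integral_meets by blast
qed

end
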